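(* Let $\mathbb X$ be a virtual equipment, let $j\colon A\to E$ and $\ell\colon A\to C$ be tight-cells, and suppose that $j$ is fully faithful. (1) Suppose that the left extension $\ell\rhd j\colon C\to E$ of $j$ along $\ell$ exists and is $j$-absolute. Then $\ell\dashv_j(\ell\rhd j)$. (2) Suppose that $j$ is dense and that $\ell$ has a right $j$-adjoint $r\colon C\to E$ (i.e. $\ell\dashv_j r$). Then $r$ exhibits the left extension $\ell\rhd j$ and this extension is $j$-absolute.
   Context: Virtual equipments. A virtual double category has objects; a category of tight-cells $f\colon A\to B$ (the composite of $f\colon A\to B$ and $g\colon B\to C$ is $gf$); loose-cells $p\colon A\nrightarrow B$; and 2-cells, each having as frame a chain of loose-cells $p_1\colon A_1\nrightarrow A_0,\dots,p_n\colon A_n\nrightarrow A_{n-1}$ ($n\ge 0$; chains are always listed in this order), a loose-cell $q\colon B_n\nrightarrow B_0$, and tight-cells $f_0\colon A_0\to B_0$ (left) and $f_n\colon A_n\to B_n$ (right); 2-cells have identities and associative unital multicategory-style composition. $\phi\colon p_1,\dots,p_n\Rightarrow q$ denotes a 2-cell whose tight-cells are identities; $(\phi_1,\dots,\phi_n)$ denotes juxtaposition. A 2-cell $q_1,\dots,q_m\Rightarrow q$ is opcartesian if every 2-cell (with any tight-cells) with domain $p_1,\dots,p_l,q_1,\dots,q_m,r_1,\dots,r_n$ factors uniquely through it; then $q$ is the loose-composite $q_1\odot\cdots\odot q_m$ (the loose-identity $A(1,1)\colon A\nrightarrow A$ if $m=0$). It is left-opcartesian if this is only required when $l=0$ and the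 left tight-cell is an identity. A unary 2-cell from $p$ to $q$ with left $f$ and right $g$ is cartesian if every 2-cell into $q$ with left $ff'$ and right $gg'$ factors uniquely through it via a 2-cell with left $f'$ and right $g'$; then $p$ is the restriction $q(f,g)$. A virtual equipment has all loose-identities and restrictions. Write $E(f,g):=E(1,1)(f,g)$; for $f\colon D\to E$, $g\colon A\to E$ it is a loose-cell $A\nrightarrow D$. The canonical isomorphisms $q(f,g)\cong C(f,1)\odot q\odot B(1,g)$ are used implicitly. A 2-cell $f\Rightarrow g$ between tight-cells $A\to B$ is equivalently a 2-cell $B(1,f)\Rightarrow B(1,g)$, or $B(g,1)\Rightarrow B(f,1)$, or $()\Rightarrow B(f,g)$. Restriction is functorial in 2-cells (contravariantly in the first argument, covariantly in the second). For $f\colon A\to B$, $\frown_f\colon ()\Rightarrow B(f,f)$ (corresponding to $1_f$) and $\smile_f\colon B(1,f),B(f,1)\Rightarrow B(1,1)$ are the canonical 2-cells (unit and counit of $B(1,f)\dashv B(f,1)$). $\phi(f,g)$ denotes the 2-cell obtained from $\phi$ by restricting along $f$ on the left and $g$ on the right. Relative adjunction. $\ell\dashv_j r$ consists of tight-cells $j\colon A\to E$, $\ell\colon A\to C$, $r\colon C\to E$ and an isomorphism $C(\ell,1)\cong E(j,r)$. Fully faithful: $\frown_j\colon()\Rightarrow E(j,j)$ is opcartesian. Colimits and left extensions. A right lift of $q\colon X\nrightarrow Z$ through $p\colon Y\nrightarrow Z$ is a loose-cell $s\colon X\nrightarrow Y$ with a 2-cell $\varpi\colon p,s\Rightarrow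 q$ such that every 2-cell $p,r_1,\dots,r_n\Rightarrow q$ ($n\ge0$) factors uniquely as $\varpi\circ(1_p,\psi)$ with $\psi\colon r_1,\dots,r_n\Rightarrow s$. For $p\colon Y\nrightarrow Z$ and $f\colon Z\to X$, a $p$-colimit of $f$ is a tight-cell $c\colon Y\to X$ with $\lambda\colon p\Rightarrow X(f,c)$ such that $(\lambda,1)$ followed by $\smile_c(f,1)$, a 2-cell $p,X(c,1)\Rightarrow X(f,1)$, exhibits $X(c,1)$ as the right lift of $X(f,1)$ through $p$. For tight-cells $k\colon Z\to Y$ and $f\colon Z\to X$, the left extension $k\rhd f\colon Y\to X$ with $\pi\colon f\Rightarrow(k\rhd f)k$ is one for which $Y(k,1)\Rightarrow X((k\rhd f)k,k\rhd f)\Rightarrow X(f,k\rhd f)$ (namely $\frown_{k\rhd f}(k,1)$ followed by $X(\pi,k\rhd f)$) exhibits $k\rhd f$ as the $Y(k,1)$-colimit of $f$. A tight-cell $j\colon A\to E$ is dense if $1_j\colon j\Rightarrow j$ exhibits $1_E$ as the left extension $j\rhd j$. A $p$-colimit $(c,\lambda)$ of $f\colon Z\to E$ (with $p\colon Y\nrightarrow Z$) is $j$-absolute if the 2-cell $E(j,f),p\Rightarrow E(j,c)$, given by $(1,\lambda)$ followed by $\smile_f(j,c)$, is left-opcartesian; a left extension $k\rhd f$ is $j$-absolute if it is so as a $Y(k,1)$-colimit. *)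

theory Defs
  imports Main
begin

section \<open>Virtual double categories\<close>

text \<open>
  A loose-cell \<open>p : A -|-> B\<close> has \<open>lsrc p = A\<close> and \<open>ltgt p = B\<close>.  A chain
  \<open>p\<^sub>1 : A\<^sub>1 -|-> A\<^sub>0, \<dots>, p\<^sub>n : A\<^sub>n -|-> A\<^sub>n\<^sub>-\<^sub>1\<close> is the list \<open>[p\<^sub>1, \<dots>, p\<^sub>n]\<close>, so it runs from the
  left object \<open>A\<^sub>0\<close> to the right object \<open>A\<^sub>n\<close> and each loose-cell has its \<^emph>\<open>target\<close> on the left.
  For a nullary 2-cell, the object at which the empty chain sits is the domain of its left
  (equally, of its right) tight-cell.

  \<open>tcomp X g f\<close> is the composite \<open>g f\<close>.  \<open>ccomp X \<psi> f [\<phi>\<^sub>1, \<dots>, \<phi>\<^sub>m]\<close> is the composite of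
  \<open>\<psi>\<close> with the juxtaposition \<open>(\<phi>\<^sub>1, \<dots>, \<phi>\<^sub>m)\<close>, where \<open>f\<close> is the leftmost tight-cell of the
  juxtaposition.  The argument \<open>f\<close> carries information only if \<open>m = 0\<close>: a nullary 2-cell at \<open>B\<close> can be
  precomposed with any tight-cell \<open>f : A \<rightarrow> B\<close> (an empty juxtaposition sits at a tight-cell).
\<close>

record ('o, 't, 'l, 'c) vdc =
  Obj :: "'o set"
  Tight :: "'t set"
  tdom :: "'t \<Rightarrow> 'o"
  tcod :: "'t \<Rightarrow> 'o"
  tid :: "'o \<Rightarrow> 't"
  tcomp :: "'t \<Rightarrow> 't \<Rightarrow> 't"
  Loose :: "'l set"
  lsrc :: "'l \<Rightarrow> 'o"
  ltgt :: "'l \<Rightarrow> 'o"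
  Cell :: "'c set"
  cdom :: "'c \<Rightarrow> 'l list"
  ccod :: "'c \<Rightarrow> 'l"
  cleft :: "'c \<Rightarrow> 't"
  cright :: "'c \<Rightarrow> 't"
  cid :: "'l \<Rightarrow> 'c"
  ccomp :: "'c \<Rightarrow> 't \<Rightarrow> 'c list \<Rightarrow> 'c"

definition tight_cell :: "('o, 't, 'l, 'c) vdc \<Rightarrow> 't \<Rightarrow> 'o \<Rightarrow> 'o \<Rightarrow> bool" where
  "tight_cell X f A B \<longleftrightarrow> f \<in> Tight X \<and> tdom X f = A \<and> tcod X f = B"

definition loose_cell :: "('o, 't, 'l, 'c) vdc \<Rightarrow> 'l \<Rightarrow> 'o \<Rightarrow> 'o \<Rightarrow> bool" where
  "loose_cell X p A B \<longleftrightarrow> p \<in> Loose X \<and> lsrc X p = A \<and> ltgt X p = B"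

fun chain :: "('o, 't, 'l, 'c) vdc \<Rightarrow> 'o \<Rightarrow> 'l list \<Rightarrow> 'o \<Rightarrow> bool" where
  "chain X A [] B \<longleftrightarrow> A \<in> Obj X \<and> B = A"
| "chain X A (p # ps) B \<longleftrightarrow> p \<in> Loose X \<and> ltgt X p = A \<and> chain X (lsrc X p) ps B"

text \<open>Horizontally adjacent 2-cells, with leftmost tight-cell \<open>f\<close> and rightmost tight-cell \<open>g\<close>.\<close>

fun juxt :: "('o, 't, 'l, 'c) vdc \<Rightarrow> 't \<Rightarrow> 'c list \<Rightarrow> 't \<Rightarrow> bool" where
  "juxt X f [] g \<longleftrightarrow> f \<in> Tight X \<and> g = f"
| "juxt X f (\<phi> # \<phi>s) g \<longleftrightarrow> \<phi> \<in> Cell X \<and> cleft X \<phi> = f \<and> juxt X (cright X \<phi>) \<phi>s g"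

definition composable ::
  "('o, 't, 'l, 'c) vdc \<Rightarrow> 'c \<Rightarrow> 't \<Rightarrow> 'c list \<Rightarrow> 't \<Rightarrow> bool" where
  "composable X \<psi> f \<phi>s g \<longleftrightarrow>
     \<psi> \<in> Cell X \<and> juxt X f \<phi>s g \<and> map (ccod X) \<phi>s = cdom X \<psi> \<and> tcod X f = tdom X (cleft X \<psi>)"

text \<open>
  \<open>ccomps X h [\<phi>\<^sub>1, \<dots>, \<phi>\<^sub>m] [\<chi>s\<^sub>1, \<dots>, \<chi>s\<^sub>m]\<close> lists the composites of the \<open>\<phi>\<^sub>i\<close> with \<open>\<chi>s\<^sub>i\<close>, where the
  concatenation of the \<open>\<chi>s\<^sub>i\<close> is a juxtaposition with leftmost tight-cell \<open>h\<close>.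
\<close>

fun ccomps :: "('o, 't, 'l, 'c) vdc \<Rightarrow> 't \<Rightarrow> 'c list \<Rightarrow> 'c list list \<Rightarrow> 'c list" where
  "ccomps X h (\<phi> # \<phi>s) (\<chi>s # \<chi>ss) =
     ccomp X \<phi> h \<chi>s # ccomps X (if \<chi>s = [] then h else cright X (last \<chi>s)) \<phi>s \<chi>ss"
| "ccomps X h _ _ = []"

locale virtual_double_category =
  fixes X :: "('o, 't, 'l, 'c) vdc"
  assumes tight_frame: "f \<in> Tight X \<Longrightarrow> tdom X f \<in> Obj X \<and> tcod X f \<in> Obj X"
    and tid: "A \<in> Obj X \<Longrightarrow> tight_cell X (tid X A) A A"
    and tcomp: "tight_cell X f A B \<Longrightarrow> tight_cell X g B C \<Longrightarrow> tight_cell X (tcomp X g f) A C"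
    and tcomp_tid: "tight_cell X f A B \<Longrightarrow> tcomp X f (tid X A) = f"
    and tid_tcomp: "tight_cell X f A B \<Longrightarrow> tcomp X (tid X B) f = f"
    and tcomp_assoc: "tight_cell X f A B \<Longrightarrow> tight_cell X g B C \<Longrightarrow> tight_cell X h C D \<Longrightarrow>
      tcomp X (tcomp X h g) f = tcomp X h (tcomp X g f)"
    and loose_frame: "p \<in> Loose X \<Longrightarrow> lsrc X p \<in> Obj X \<and> ltgt X p \<in> Obj X"
    and cell_left: "\<phi> \<in> Cell X \<Longrightarrow> cleft X \<phi> \<in> Tight X"
    and cell_right: "\<phi> \<in> Cell X \<Longrightarrow> cright X \<phi> \<in> Tight X"
    and cell_dom: "\<phi> \<in> Cell X \<Longrightarrow>
      chain X (tdom X (cleft X \<phi>)) (cdom X \<phi>) (tdom X (cright X \<phi>))"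
    and cell_cod: "\<phi> \<in> Cell X \<Longrightarrow>
      loose_cell X (ccod X \<phi>) (tcod X (cright X \<phi>)) (tcod X (cleft X \<phi>))"
    and cid: "p \<in> Loose X \<Longrightarrow>
      cid X p \<in> Cell X \<and> cdom X (cid X p) = [p] \<and> ccod X (cid X p) = p \<and>
      cleft X (cid X p) = tid X (ltgt X p) \<and> cright X (cid X p) = tid X (lsrc X p)"
    and ccomp: "composable X \<psi> f \<phi>s g \<Longrightarrow>
      ccomp X \<psi> f \<phi>s \<in> Cell X \<and> cdom X (ccomp X \<psi> f \<phi>s) = concat (map (cdom X) \<phi>s) \<and>
      ccod X (ccomp X \<psi> f \<phi>s) = ccod X \<psi> \<and>
      cleft X (ccomp X \<psi> f \<phi>s) = tcomp X (cleft X \<psi>) f \<and>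
      cright X (ccomp X \<psi> f \<phi>s) = tcomp X (cright X \<psi>) g"
    and ccomp_cid: "\<psi> \<in> Cell X \<Longrightarrow>
      ccomp X \<psi> (tid X (tdom X (cleft X \<psi>))) (map (cid X) (cdom X \<psi>)) = \<psi>"
    and cid_ccomp: "\<phi> \<in> Cell X \<Longrightarrow> ccomp X (cid X (ccod X \<phi>)) (cleft X \<phi>) [\<phi>] = \<phi>"
    and ccomp_assoc: "composable X \<psi> f \<phi>s g \<Longrightarrow> juxt X h (concat \<chi>ss) k \<Longrightarrow>
      map (map (ccod X)) \<chi>ss = map (cdom X) \<phi>s \<Longrightarrow> tcod X h = tdom X f \<Longrightarrow>
      ccomp X (ccomp X \<psi> f \<phi>s) h (concat \<chi>ss) = ccomp X \<psi> (tcomp X f h) (ccomps X h \<phi>s \<chi>ss)"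

text \<open>2-cells \<open>\<phi> : p\<^sub>1, \<dots>, p\<^sub>n \<Rightarrow> q\<close> whose tight-cells are identities.\<close>

definition gcell :: "('o, 't, 'l, 'c) vdc \<Rightarrow> 'c \<Rightarrow> 'l list \<Rightarrow> 'l \<Rightarrow> bool" where
  "gcell X \<phi> ps q \<longleftrightarrow> \<phi> \<in> Cell X \<and> cdom X \<phi> = ps \<and> ccod X \<phi> = q \<and>
     cleft X \<phi> = tid X (ltgt X q) \<and> cright X \<phi> = tid X (lsrc X q)"

text \<open>The composite of \<open>\<psi>\<close> with a juxtaposition of 2-cells whose leftmost tight-cell is an identity.\<close>

definition gcomp :: "('o, 't, 'l, 'c) vdc \<Rightarrow> 'c \<Rightarrow> 'c list \<Rightarrow> 'c" where
  "gcomp X \<psi> \<phi>s = ccomp X \<psi> (tid X (tdom X (cleft X \<psi>))) \<phi>s"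

definition iso_gcell :: "('o, 't, 'l, 'c) vdc \<Rightarrow> 'c \<Rightarrow> 'l \<Rightarrow> 'l \<Rightarrow> bool" where
  "iso_gcell X \<phi> p q \<longleftrightarrow> gcell X \<phi> [p] q \<and>
     (\<exists>\<phi>'. gcell X \<phi>' [q] p \<and> gcomp X \<phi>' [\<phi>] = cid X p \<and> gcomp X \<phi> [\<phi>'] = cid X q)"

section \<open>Universal 2-cells and virtual equipments\<close>

definition opcart_factor ::
  "('o, 't, 'l, 'c) vdc \<Rightarrow> 'c \<Rightarrow> 'l list \<Rightarrow> 'l list \<Rightarrow> 'c \<Rightarrow> 'c \<Rightarrow> bool" where
  "opcart_factor X \<phi> ps rs \<theta> \<psi> \<longleftrightarrow>
     \<psi> \<in> Cell X \<and> cdom X \<psi> = ps @ [ccod X \<phi>] @ rs \<and> ccod X \<psi> = ccod X \<theta> \<and>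
     cleft X \<psi> = cleft X \<theta> \<and> cright X \<psi> = cright X \<theta> \<and>
     gcomp X \<psi> (map (cid X) ps @ [\<phi>] @ map (cid X) rs) = \<theta>"

text \<open>
  If \<open>cdom X \<phi>\<close> is empty, the premise on \<open>ps\<close> says at which object of the chain \<open>ps @ rs\<close> the nullary
  2-cell \<open>\<phi>\<close> is to be inserted; otherwise it is automatic.
\<close>

definition opcartesian :: "('o, 't, 'l, 'c) vdc \<Rightarrow> 'c \<Rightarrow> bool" where
  "opcartesian X \<phi> \<longleftrightarrow> gcell X \<phi> (cdom X \<phi>) (ccod X \<phi>) \<and>
     (\<forall>\<theta> ps rs. \<theta> \<in> Cell X \<and> cdom X \<theta> = ps @ cdom X \<phi> @ rs \<and>
        chain X (tdom X (cleft X \<theta>)) ps (tdom X (cleft X \<phi>)) \<longrightarrow>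
        (\<exists>!\<psi>. opcart_factor X \<phi> ps rs \<theta> \<psi>))"

definition left_opcartesian :: "('o, 't, 'l, 'c) vdc \<Rightarrow> 'c \<Rightarrow> bool" where
  "left_opcartesian X \<phi> \<longleftrightarrow> gcell X \<phi> (cdom X \<phi>) (ccod X \<phi>) \<and>
     (\<forall>\<theta> rs. \<theta> \<in> Cell X \<and> cdom X \<theta> = cdom X \<phi> @ rs \<and> cleft X \<theta> = cleft X \<phi> \<longrightarrow>
        (\<exists>!\<psi>. opcart_factor X \<phi> [] rs \<theta> \<psi>))"

definition cart_factor ::
  "('o, 't, 'l, 'c) vdc \<Rightarrow> 'c \<Rightarrow> 't \<Rightarrow> 't \<Rightarrow> 'c \<Rightarrow> 'c \<Rightarrow> bool" where
  "cart_factor X \<kappa> f g \<theta> \<psi> \<longleftrightarrow>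
     \<psi> \<in> Cell X \<and> cdom X \<psi> = cdom X \<theta> \<and> [ccod X \<psi>] = cdom X \<kappa> \<and>
     cleft X \<psi> = f \<and> cright X \<psi> = g \<and> ccomp X \<kappa> f [\<psi>] = \<theta>"

definition cartesian :: "('o, 't, 'l, 'c) vdc \<Rightarrow> 'c \<Rightarrow> bool" where
  "cartesian X \<kappa> \<longleftrightarrow> \<kappa> \<in> Cell X \<and> length (cdom X \<kappa>) = 1 \<and>
     (\<forall>\<theta> f g. \<theta> \<in> Cell X \<and> ccod X \<theta> = ccod X \<kappa> \<and>
        f \<in> Tight X \<and> tcod X f = tdom X (cleft X \<kappa>) \<and> cleft X \<theta> = tcomp X (cleft X \<kappa>) f \<and>
        g \<in> Tight X \<and> tcod X g = tdom X (cright X \<kappa>) \<and> cright X \<theta> = tcomp X (cright X \<kappa>) g \<longrightarrow>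
        (\<exists>!\<psi>. cart_factor X \<kappa> f g \<theta> \<psi>))"

definition is_loose_identity :: "('o, 't, 'l, 'c) vdc \<Rightarrow> 'o \<Rightarrow> 'c \<Rightarrow> bool" where
  "is_loose_identity X A \<eta> \<longleftrightarrow>
     opcartesian X \<eta> \<and> cdom X \<eta> = [] \<and> loose_cell X (ccod X \<eta>) A A"

definition is_restriction ::
  "('o, 't, 'l, 'c) vdc \<Rightarrow> 'l \<Rightarrow> 't \<Rightarrow> 't \<Rightarrow> 'c \<Rightarrow> bool" where
  "is_restriction X q f g \<kappa> \<longleftrightarrow>
     cartesian X \<kappa> \<and> ccod X \<kappa> = q \<and> cleft X \<kappa> = f \<and> cright X \<kappa> = g"

locale virtual_equipment = virtual_double_category X
  for X :: "('o, 't, 'l, 'c) vdc" +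
  assumes loose_identities: "A \<in> Obj X \<Longrightarrow> \<exists>\<eta>. is_loose_identity X A \<eta>"
    and restrictions: "loose_cell X q B' B \<Longrightarrow> tight_cell X f A B \<Longrightarrow> tight_cell X g A' B' \<Longrightarrow>
      \<exists>\<kappa>. is_restriction X q f g \<kappa>"

section \<open>Calculus in a virtual equipment\<close>

text \<open>
  Loose-identities and restrictions are determined up to unique isomorphism; the definitions below
  fix an arbitrary choice: \<open>lid_cell X A : () \<Rightarrow> A(1,1)\<close>, and the cartesian 2-cell
  \<open>hom_cell X f g\<close> from \<open>hom X f g = E(f,g)\<close> to \<open>E(1,1)\<close>, where \<open>E\<close> is the common codomain
  of \<open>f\<close> and \<open>g\<close>.
\<close>

definition lid_cell :: "('o, 't, 'l, 'c) vdc \<Rightarrow> 'o \<Rightarrow> 'c" where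
  "lid_cell X A = (SOME \<eta>. is_loose_identity X A \<eta>)"

definition lid :: "('o, 't, 'l, 'c) vdc \<Rightarrow> 'o \<Rightarrow> 'l" where
  "lid X A = ccod X (lid_cell X A)"

definition hom_cell :: "('o, 't, 'l, 'c) vdc \<Rightarrow> 't \<Rightarrow> 't \<Rightarrow> 'c" where
  "hom_cell X f g = (SOME \<kappa>. is_restriction X (lid X (tcod X f)) f g \<kappa>)"

definition hom :: "('o, 't, 'l, 'c) vdc \<Rightarrow> 't \<Rightarrow> 't \<Rightarrow> 'l" where
  "hom X f g = hd (cdom X (hom_cell X f g))"

text \<open>
  The canonical cartesian 2-cell from \<open>E(f h, g k)\<close> to \<open>E(f,g)\<close>, with left tight-cell \<open>h\<close> and right
  tight-cell \<open>k\<close>, exhibiting the canonical isomorphism \<open>E(f h, g k) \<cong> E(f,g)(h,k)\<close>.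
\<close>

definition hom_restr :: "('o, 't, 'l, 'c) vdc \<Rightarrow> 't \<Rightarrow> 't \<Rightarrow> 't \<Rightarrow> 't \<Rightarrow> 'c" where
  "hom_restr X f g h k =
     (THE \<rho>. cart_factor X (hom_cell X f g) h k (hom_cell X (tcomp X f h) (tcomp X g k)) \<rho>)"

text \<open>
  The restriction \<open>\<phi>(f,g)\<close> of \<open>\<phi> : p\<^sub>1, \<dots>, p\<^sub>n \<Rightarrow> q\<close>, relative to a cartesian 2-cell \<open>\<kappa>\<close> exhibiting
  \<open>q(f,g)\<close> and to 2-cells \<open>\<kappa>s\<close> exhibiting the restricted domain, for instance \<open>p\<^sub>1(f,1), p\<^sub>2(1,g)\<close> if
  \<open>n = 2\<close>.
\<close>

definition restrict_cell :: "('o, 't, 'l, 'c) vdc \<Rightarrow> 'c \<Rightarrow> 'c list \<Rightarrow> 'c \<Rightarrow> 'c" where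
  "restrict_cell X \<phi> \<kappa>s \<kappa> =
     (THE \<psi>. cart_factor X \<kappa> (tid X (tdom X (cleft X \<kappa>))) (tid X (tdom X (cright X \<kappa>)))
        (ccomp X \<phi> (cleft X \<kappa>) \<kappa>s) \<psi>)"

text \<open>\<open>frown X f : () \<Rightarrow> B(f,f)\<close> and its unary form \<open>A(1,1) \<Rightarrow> B(f,f)\<close>, for \<open>f : A \<rightarrow> B\<close>\<close>

definition frown :: "('o, 't, 'l, 'c) vdc \<Rightarrow> 't \<Rightarrow> 'c" where
  "frown X f = (THE \<phi>. cart_factor X (hom_cell X f f) (tid X (tdom X f)) (tid X (tdom X f))
     (ccomp X (lid_cell X (tcod X f)) f []) \<phi>)"

definition frown1 :: "('o, 't, 'l, 'c) vdc \<Rightarrow> 't \<Rightarrow> 'c" where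
  "frown1 X f = (THE \<phi>. opcart_factor X (lid_cell X (tdom X f)) [] [] (frown X f) \<phi>)"

text \<open>The canonical 2-cell \<open>B(1,1), B(1,1) \<Rightarrow> B(1,1)\<close>\<close>

definition lid_mult :: "('o, 't, 'l, 'c) vdc \<Rightarrow> 'o \<Rightarrow> 'c" where
  "lid_mult X B = (THE \<mu>. opcart_factor X (lid_cell X B) [] [lid X B] (cid X (lid X B)) \<mu>)"

text \<open>\<open>smile X f : B(1,f), B(f,1) \<Rightarrow> B(1,1)\<close>, for \<open>f : A \<rightarrow> B\<close>\<close>

definition smile :: "('o, 't, 'l, 'c) vdc \<Rightarrow> 't \<Rightarrow> 'c" where
  "smile X f = gcomp X (lid_mult X (tcod X f))
     [hom_cell X (tid X (tcod X f)) f, hom_cell X f (tid X (tcod X f))]"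

text \<open>\<open>smile_at X f g h\<close> is the restriction of \<open>smile X f\<close> along \<open>g\<close> and \<open>h\<close>, regarded as a 2-cell
  \<open>B(g,f), B(f,h) \<Rightarrow> B(g,h)\<close>.\<close>

definition smile_at :: "('o, 't, 'l, 'c) vdc \<Rightarrow> 't \<Rightarrow> 't \<Rightarrow> 't \<Rightarrow> 'c" where
  "smile_at X f g h = restrict_cell X (smile X f)
     [hom_restr X (tid X (tcod X f)) f g (tid X (tdom X f)),
      hom_restr X f (tid X (tcod X f)) (tid X (tdom X f)) h]
     (hom_cell X g h)"

text \<open>\<open>frown_at X g k\<close> is the restriction of \<open>frown X g\<close> along \<open>k : Z \<rightarrow> Y\<close> and \<open>1\<^sub>Y\<close>, regarded as a 2-cell
  \<open>Y(k,1) \<Rightarrow> X(g k, g)\<close>.\<close>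

definition frown_at :: "('o, 't, 'l, 'c) vdc \<Rightarrow> 't \<Rightarrow> 't \<Rightarrow> 'c" where
  "frown_at X g k = restrict_cell X (frown1 X g)
     [hom_cell X k (tid X (tdom X g))] (hom_restr X g g k (tid X (tdom X g)))"

text \<open>A 2-cell \<open>f \<Rightarrow> g\<close> between tight-cells \<open>A \<rightarrow> B\<close> is represented by a 2-cell \<open>() \<Rightarrow> B(f,g)\<close>.\<close>

definition tight_2cell :: "('o, 't, 'l, 'c) vdc \<Rightarrow> 'c \<Rightarrow> 't \<Rightarrow> 't \<Rightarrow> bool" where
  "tight_2cell X \<pi> f g \<longleftrightarrow> f \<in> Tight X \<and> g \<in> Tight X \<and>
     tdom X f = tdom X g \<and> tcod X f = tcod X g \<and> gcell X \<pi> [] (hom X f g)"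

text \<open>\<open>B(\<pi>,h) : B(g,h) \<Rightarrow> B(f,h)\<close>, for \<open>\<pi> : f \<Rightarrow> g\<close>\<close>

definition hom_act :: "('o, 't, 'l, 'c) vdc \<Rightarrow> 'c \<Rightarrow> 't \<Rightarrow> 't \<Rightarrow> 't \<Rightarrow> 'c" where
  "hom_act X \<pi> f g h = gcomp X (smile_at X g f h) [\<pi>, cid X (hom X g h)]"

section \<open>Relative adjunctions, colimits and left extensions\<close>

definition relative_adjunction ::
  "('o, 't, 'l, 'c) vdc \<Rightarrow> 't \<Rightarrow> 't \<Rightarrow> 't \<Rightarrow> 'c \<Rightarrow> bool" where
  "relative_adjunction X j l r \<alpha> \<longleftrightarrow>
     (\<exists>A C E. tight_cell X j A E \<and> tight_cell X l A C \<and> tight_cell X r C E \<and>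
        iso_gcell X \<alpha> (hom X l (tid X C)) (hom X j r))"

definition fully_faithful :: "('o, 't, 'l, 'c) vdc \<Rightarrow> 't \<Rightarrow> bool" where
  "fully_faithful X j \<longleftrightarrow> j \<in> Tight X \<and> opcartesian X (frown X j)"

definition right_lift :: "('o, 't, 'l, 'c) vdc \<Rightarrow> 'l \<Rightarrow> 'l \<Rightarrow> 'l \<Rightarrow> 'c \<Rightarrow> bool" where
  "right_lift X p q s \<omega> \<longleftrightarrow>
     p \<in> Loose X \<and> q \<in> Loose X \<and> loose_cell X s (lsrc X q) (lsrc X p) \<and> gcell X \<omega> [p, s] q \<and>
     (\<forall>rs \<theta>. gcell X \<theta> (p # rs) q \<longrightarrow>
        (\<exists>!\<psi>. gcell X \<psi> rs s \<and> gcomp X \<omega> [cid X p, \<psi>] = \<theta>))"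

text \<open>\<open>is_colimit X p f c \<lambda>\<close>: \<open>(c, \<lambda>)\<close> is a \<open>p\<close>-colimit of \<open>f\<close>.\<close>

definition is_colimit ::
  "('o, 't, 'l, 'c) vdc \<Rightarrow> 'l \<Rightarrow> 't \<Rightarrow> 't \<Rightarrow> 'c \<Rightarrow> bool" where
  "is_colimit X p f c lam \<longleftrightarrow>
     (\<exists>Y Z W. loose_cell X p Y Z \<and> tight_cell X f Z W \<and> tight_cell X c Y W \<and>
        gcell X lam [p] (hom X f c) \<and>
        right_lift X p (hom X f (tid X W)) (hom X c (tid X W))
          (gcomp X (smile_at X c f (tid X W)) [lam, cid X (hom X c (tid X W))]))"

definition absolute_colimit ::
  "('o, 't, 'l, 'c) vdc \<Rightarrow> 't \<Rightarrow> 'l \<Rightarrow> 't \<Rightarrow> 't \<Rightarrow> 'c \<Rightarrow> bool" where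
  "absolute_colimit X j p f c lam \<longleftrightarrow> is_colimit X p f c lam \<and>
     j \<in> Tight X \<and> tcod X j = tcod X f \<and>
     left_opcartesian X (gcomp X (smile_at X f j c) [cid X (hom X j f), lam])"

text \<open>The 2-cell \<open>Y(k,1) \<Rightarrow> X(g k, g) \<Rightarrow> X(f,g)\<close> induced by \<open>\<pi> : f \<Rightarrow> g k\<close>\<close>

definition ext_cell :: "('o, 't, 'l, 'c) vdc \<Rightarrow> 't \<Rightarrow> 't \<Rightarrow> 't \<Rightarrow> 'c \<Rightarrow> 'c" where
  "ext_cell X k f g \<pi> = gcomp X (hom_act X \<pi> f (tcomp X g k) g) [frown_at X g k]"

text \<open>\<open>is_left_extension X k f g \<pi>\<close>: \<open>\<pi> : f \<Rightarrow> g k\<close> exhibits \<open>g\<close> as the left extension of \<open>f\<close>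
  along \<open>k\<close>.\<close>

definition is_left_extension ::
  "('o, 't, 'l, 'c) vdc \<Rightarrow> 't \<Rightarrow> 't \<Rightarrow> 't \<Rightarrow> 'c \<Rightarrow> bool" where
  "is_left_extension X k f g \<pi> \<longleftrightarrow>
     (\<exists>Y Z W. tight_cell X k Z Y \<and> tight_cell X f Z W \<and> tight_cell X g Y W \<and>
        tight_2cell X \<pi> f (tcomp X g k) \<and>
        is_colimit X (hom X k (tid X Y)) f g (ext_cell X k f g \<pi>))"

definition absolute_left_extension ::
  "('o, 't, 'l, 'c) vdc \<Rightarrow> 't \<Rightarrow> 't \<Rightarrow> 't \<Rightarrow> 't \<Rightarrow> 'c \<Rightarrow> bool" where
  "absolute_left_extension X j k f g \<pi> \<longleftrightarrow> is_left_extension X k f g \<pi> \<and>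
     absolute_colimit X j (hom X k (tid X (tcod X k))) f g (ext_cell X k f g \<pi>)"

text \<open>Here \<open>frown X j\<close> represents \<open>1\<^sub>j : j \<Rightarrow> 1\<^sub>E j\<close>.\<close>

definition dense_tight :: "('o, 't, 'l, 'c) vdc \<Rightarrow> 't \<Rightarrow> bool" where
  "dense_tight X j \<longleftrightarrow> is_left_extension X j j (tid X (tcod X j)) (frown X j)"

end

theory Submission
  imports Defs
begin

text \<open>
  Absoluteness says that the composite \<open>E(j,j), C(l,1) \<Rightarrow> E(j,r)\<close> is left-opcartesian.  As \<open>j\<close> is fully
  faithful, \<open>frown X j : () \<Rightarrow> E(j,j)\<close> is opcartesian, so this holds iff precomposing with \<open>frown X j\<close>
  gives an isomorphism \<open>C(l,1) \<cong> E(j,r)\<close>.  Conversely, by Yoneda an isomorphism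
  \<open>\<alpha> : C(l,1) \<cong> E(j,r)\<close> is induced by a unique \<open>\<pi> : j \<Rightarrow> r l\<close>, and density of \<open>j\<close> gives the universal
  property of the colimit: since \<open>E(j,r)\<close> is \<open>E(j,1) \<odot> E(1,r)\<close> and \<open>E(1,r)\<close> is left adjoint to \<open>E(r,1)\<close>, the right lift of
  \<open>E(j,1)\<close> through \<open>E(j,r)\<close> is obtained from the one through \<open>E(j,1)\<close>.
\<close>

section \<open>Composition of 2-cells\<close>

text \<open>The obstacle is coherence. \<open>hom\<close>, \<open>lid\<close> and all restrictions
  are arbitrary choices, so \<open>E(f h, g k)\<close> and \<open>E(f,g)(h,k)\<close> are merely
  isomorphic, and a literal calculus would carry comparison cells through every equation. As the
  chosen 2-cells into \<open>E(1,1)\<close> are cartesian, a 2-cell into \<open>E(f,g)\<close> may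
  be replaced by its composite with the chosen one, which moves \<open>f\<close> and
  \<open>g\<close> into the frame. There the counit \<open>smile\<close> is the multiplication of
  \<open>E(1,1)\<close>, and triangle identities are unit laws. The composite of
  \<open>E(j,1)\<close> and \<open>E(1,r)\<close> is never formed. It is replaced by a 2-cell
  \<open>m : E(j,1), E(1,r) \<Rightarrow> E(j,r)\<close> and a pair \<open>(n, v)\<close> of
  non-globular cells that meet at the tight-cell \<open>r\<close>, such that \<open>m\<close> after
  \<open>(n, v)\<close> is an identity. Likewise the universal element of \<open>C(l,1)\<close> is a
  nullary cell with right tight-cell \<open>l\<close>, so that Yoneda is a computation with one
  cell. An empty juxtaposition does not determine the tight-cell at which it sits; hence the
  explicit leftmost tight-cells in all composites.\<close>

lemma juxt_rightmost:
  "juxt X f \<phi>s g \<Longrightarrow> (if \<phi>s = [] then f else cright X (last \<phi>s)) = g"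
  by (induction \<phi>s arbitrary: f) (auto split: if_splits)

context virtual_double_category
begin

lemma juxt_Tight: "juxt X f \<phi>s g \<Longrightarrow> f \<in> Tight X"
  using cell_left by (cases \<phi>s) auto

lemma juxt_append:
  "juxt X f (\<phi>s @ \<psi>s) g \<longleftrightarrow> (\<exists>m. juxt X f \<phi>s m \<and> juxt X m \<psi>s g)"
  by (induction \<phi>s arbitrary: f) (auto dest: juxt_Tight)

text \<open>\<open>m\<close> has to be supplied: if the first block of \<open>\<chi>ss'\<close> is
  empty, no cell in it records where it sits, and that tight-cell is inherited from the end of
  \<open>concat \<chi>ss\<close>.\<close>

lemma ccomps_append:
  assumes "length \<phi>s = length \<chi>ss" and "juxt X h (concat \<chi>ss) m"
  shows "ccomps X h (\<phi>s @ \<phi>s') (\<chi>ss @ \<chi>ss') = ccomps X h \<phi>s \<chi>ss @ ccomps X m \<phi>s' \<chi>ss'"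
  using assms
proof (induction \<phi>s \<chi>ss arbitrary: h rule: list_induct2)
  case (Cons \<phi> \<phi>s \<chi>s \<chi>ss)
  then obtain k where "juxt X h \<chi>s k" "juxt X k (concat \<chi>ss) m"
    by (auto simp: juxt_append)
  with Cons show ?case
    using juxt_rightmost[of X h \<chi>s k] by simp
qed simp

lemma chain_Obj: "chain X A ps B \<Longrightarrow> A \<in> Obj X"
  using loose_frame by (cases ps) auto

lemma chain_append:
  "chain X A (ps @ qs) B \<longleftrightarrow> (\<exists>M. chain X A ps M \<and> chain X M qs B)"
  by (induction ps arbitrary: A) (auto dest: chain_Obj)

lemma tid_simps [simp]:
  assumes "A \<in> Obj X"
  shows "tid X A \<in> Tight X" "tdom X (tid X A) = A" "tcod X (tid X A) = A"
  using tid[OF assms] by (auto simp: tight_cell_def)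

lemma tcomp_simps [simp]:
  assumes "f \<in> Tight X" and "g \<in> Tight X" and "tcod X f = tdom X g"
  shows "tcomp X g f \<in> Tight X" "tdom X (tcomp X g f) = tdom X f" "tcod X (tcomp X g f) = tcod X g"
  using tcomp[of f _ _ g] assms by (auto simp: tight_cell_def)

lemma tcomp_tid_simps [simp]:
  assumes "f \<in> Tight X"
  shows "tdom X f = A \<Longrightarrow> tcomp X f (tid X A) = f" "tcod X f = B \<Longrightarrow> tcomp X (tid X B) f = f"
  using tcomp_tid[of f] tid_tcomp[of f] assms by (auto simp: tight_cell_def)

lemma tdom_Obj [simp]: "f \<in> Tight X \<Longrightarrow> tdom X f \<in> Obj X"
  and tcod_Obj [simp]: "f \<in> Tight X \<Longrightarrow> tcod X f \<in> Obj X"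
  using tight_frame by auto

lemma lsrc_Obj [simp]: "p \<in> Loose X \<Longrightarrow> lsrc X p \<in> Obj X"
  and ltgt_Obj [simp]: "p \<in> Loose X \<Longrightarrow> ltgt X p \<in> Obj X"
  using loose_frame by auto

lemma cell_simps [simp]:
  assumes "\<phi> \<in> Cell X"
  shows "cleft X \<phi> \<in> Tight X" "cright X \<phi> \<in> Tight X" "ccod X \<phi> \<in> Loose X"
  using assms cell_left cell_right cell_cod by (auto simp: loose_cell_def)

lemma cid_simps [simp]:
  assumes "p \<in> Loose X"
  shows "cid X p \<in> Cell X" "cdom X (cid X p) = [p]" "ccod X (cid X p) = p"
    "cleft X (cid X p) = tid X (ltgt X p)" "cright X (cid X p) = tid X (lsrc X p)"
  using cid[OF assms] by auto

lemma ccod_frame: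
  assumes "\<phi> \<in> Cell X"
  shows "ltgt X (ccod X \<phi>) = tcod X (cleft X \<phi>)" "lsrc X (ccod X \<phi>) = tcod X (cright X \<phi>)"
  using cell_cod[OF assms] by (auto simp: loose_cell_def)

lemma ccomp_simps [simp]:
  assumes "\<psi> \<in> Cell X" and "juxt X f \<phi>s g" and "map (ccod X) \<phi>s = cdom X \<psi>"
    and "tcod X f = tdom X (cleft X \<psi>)"
  shows "ccomp X \<psi> f \<phi>s \<in> Cell X" "cdom X (ccomp X \<psi> f \<phi>s) = concat (map (cdom X) \<phi>s)"
    "ccod X (ccomp X \<psi> f \<phi>s) = ccod X \<psi>"
    "cleft X (ccomp X \<psi> f \<phi>s) = tcomp X (cleft X \<psi>) f"
    "cright X (ccomp X \<psi> f \<phi>s) = tcomp X (cright X \<psi>) g"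
  using ccomp[of \<psi> f \<phi>s g] assms by (auto simp: composable_def)

lemma juxt_cids:
  "chain X A ps B \<Longrightarrow> juxt X (tid X A) (map (cid X) ps) (tid X B)"
  by (induction ps arbitrary: A) auto

lemma map_ccod_cids [simp]:
  "set ps \<subseteq> Loose X \<Longrightarrow> map (ccod X \<circ> cid X) ps = ps"
  by (induction ps) auto

lemma concat_cdom_cids [simp]:
  "set ps \<subseteq> Loose X \<Longrightarrow> concat (map (cdom X \<circ> cid X) ps) = ps"
  by (induction ps) auto

lemma chain_Loose: "chain X A ps B \<Longrightarrow> set ps \<subseteq> Loose X"
  by (induction ps arbitrary: A) auto

lemma ccomps_cids:
  "juxt X h \<rho>s k \<Longrightarrow> ccomps X h (map (cid X) (map (ccod X) \<rho>s)) (map (\<lambda>\<rho>. [\<rho>]) \<rho>s) = \<rho>s"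
  by (induction \<rho>s arbitrary: h) (auto simp: cid_ccomp)

text \<open>Universal properties of opcartesian cells speak of cells padded by identities. Cutting
  the tail \<open>\<rho>s\<close> into singletons makes associativity apply, and composing each
  identity with its singleton gives back \<open>\<rho>s\<close>.\<close>

lemma ccomp_assoc_tail:
  assumes "\<psi> \<in> Cell X" and "juxt X f \<phi>s g" and "juxt X g (map (cid X) rs) g'"
    and "map (ccod X) \<phi>s @ rs = cdom X \<psi>" and "tcod X f = tdom X (cleft X \<psi>)"
    and "juxt X h (concat \<chi>ss) k" and "juxt X k \<rho>s k'"
    and "map (map (ccod X)) \<chi>ss = map (cdom X) \<phi>s" and "map (ccod X) \<rho>s = rs"
    and "tcod X h = tdom X f"
  shows "ccomp X (ccomp X \<psi> f (\<phi>s @ map (cid X) rs)) h (concat \<chi>ss @ \<rho>s) =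
    ccomp X \<psi> (tcomp X f h) (ccomps X h \<phi>s \<chi>ss @ \<rho>s)"
proof -
  have rs: "set rs \<subseteq> Loose X"
    using assms(4) cell_dom[OF assms(1)] chain_Loose by (metis le_sup_iff set_append)
  have len: "length \<phi>s = length \<chi>ss"
    using assms(8) by (metis length_map)
  have "ccomp X (ccomp X \<psi> f (\<phi>s @ map (cid X) rs)) h (concat (\<chi>ss @ map (\<lambda>\<rho>. [\<rho>]) \<rho>s)) =
    ccomp X \<psi> (tcomp X f h) (ccomps X h (\<phi>s @ map (cid X) rs) (\<chi>ss @ map (\<lambda>\<rho>. [\<rho>]) \<rho>s))"
  proof (rule ccomp_assoc)
    show "composable X \<psi> f (\<phi>s @ map (cid X) rs) g'"
      using assms rs map_ccod_cids[OF rs] by (auto simp: composable_def juxt_append)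
    show "juxt X h (concat (\<chi>ss @ map (\<lambda>\<rho>. [\<rho>]) \<rho>s)) k'"
      using assms(6,7) by (auto simp: juxt_append)
    have "map (map (ccod X)) (map (\<lambda>\<rho>. [\<rho>]) \<rho>s) = map (cdom X) (map (cid X) rs)"
      using assms(9) rs by (auto simp: image_subset_iff)
    then show "map (map (ccod X)) (\<chi>ss @ map (\<lambda>\<rho>. [\<rho>]) \<rho>s) = map (cdom X) (\<phi>s @ map (cid X) rs)"
      using assms(8) by simp
  qed fact
  then show ?thesis
    using ccomps_append[OF len assms(6)] ccomps_cids[OF assms(7)] assms(9) by simp
qed

section \<open>Cancellation of universal 2-cells\<close>

text \<open>Both cells factor the common composite \<open>\<theta>\<close> through
  \<open>\<phi>\<close>, so uniqueness identifies them. This is how equations between cells out of a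
  loose-identity are later tested on its unit.\<close>

lemma opcartesian_cancel:
  assumes "opcartesian X \<phi>" and "\<psi> \<in> Cell X" and "\<psi>' \<in> Cell X"
    and "cdom X \<psi> = ps @ [ccod X \<phi>] @ rs" and "cdom X \<psi>' = cdom X \<psi>" and "ccod X \<psi>' = ccod X \<psi>"
    and "cleft X \<psi>' = cleft X \<psi>" and "cright X \<psi>' = cright X \<psi>"
    and eq: "ccomp X \<psi> (tid X (tdom X (cleft X \<psi>))) (map (cid X) ps @ [\<phi>] @ map (cid X) rs) =
      ccomp X \<psi>' (tid X (tdom X (cleft X \<psi>))) (map (cid X) ps @ [\<phi>] @ map (cid X) rs)"
  shows "\<psi> = \<psi>'"
proof -
  define \<theta> where
    "\<theta> = ccomp X \<psi> (tid X (tdom X (cleft X \<psi>))) (map (cid X) ps @ [\<phi>] @ map (cid X) rs)"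
  have \<phi>: "\<phi> \<in> Cell X" "cleft X \<phi> = tid X (ltgt X (ccod X \<phi>))"
      "cright X \<phi> = tid X (lsrc X (ccod X \<phi>))"
    using assms(1) by (auto simp: opcartesian_def gcell_def)
  have ch: "chain X (tdom X (cleft X \<psi>)) ps (ltgt X (ccod X \<phi>))"
    "chain X (lsrc X (ccod X \<phi>)) rs (tdom X (cright X \<psi>))"
    using cell_dom[OF assms(2)] assms(4) by (auto simp: chain_append)
  have sub: "set ps \<subseteq> Loose X" "set rs \<subseteq> Loose X"
    using ch chain_Loose by auto
  have jx: "juxt X (tid X (tdom X (cleft X \<psi>))) (map (cid X) ps @ [\<phi>] @ map (cid X) rs)
      (tid X (tdom X (cright X \<psi>)))"
    using juxt_cids[OF ch(1)] juxt_cids[OF ch(2)] \<phi> by (auto simp: juxt_append)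
  have mp: "map (ccod X) (map (cid X) ps @ [\<phi>] @ map (cid X) rs) = cdom X \<psi>"
    using assms(4) map_ccod_cids[OF sub(1)] map_ccod_cids[OF sub(2)] by simp
  have \<theta>: "\<theta> \<in> Cell X" "cdom X \<theta> = ps @ cdom X \<phi> @ rs" "ccod X \<theta> = ccod X \<psi>"
      "cleft X \<theta> = cleft X \<psi>" "cright X \<theta> = cright X \<psi>"
    using ccomp_simps[OF assms(2) jx mp] concat_cdom_cids[OF sub(1)] concat_cdom_cids[OF sub(2)]
      assms(2)
    by (auto simp: \<theta>_def)
  have "\<exists>!\<psi>. opcart_factor X \<phi> ps rs \<theta> \<psi>"
    using assms(1) \<theta> ch(1) \<phi> by (auto simp: opcartesian_def)
  moreover have "opcart_factor X \<phi> ps rs \<theta> \<psi>" "opcart_factor X \<phi> ps rs \<theta> \<psi>'"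
    using assms \<theta> by (auto simp: opcart_factor_def gcomp_def \<theta>_def)
  ultimately show ?thesis by blast
qed

lemma cartesian_cancel:
  assumes "cartesian X \<kappa>" and "\<psi> \<in> Cell X" and "\<psi>' \<in> Cell X"
    and "cdom X \<kappa> = [ccod X \<psi>]" and "cdom X \<psi>' = cdom X \<psi>" and "ccod X \<psi>' = ccod X \<psi>"
    and "cleft X \<psi>' = cleft X \<psi>" and "cright X \<psi>' = cright X \<psi>"
    and eq: "ccomp X \<kappa> (cleft X \<psi>) [\<psi>] = ccomp X \<kappa> (cleft X \<psi>) [\<psi>']"
  shows "\<psi> = \<psi>'"
proof -
  have \<kappa>: "\<kappa> \<in> Cell X"
    using assms(1) by (simp add: cartesian_def)
  have fr: "tcod X (cleft X \<psi>) = tdom X (cleft X \<kappa>)" "tcod X (cright X \<psi>) = tdom X (cright X \<kappa>)"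
    using cell_dom[OF \<kappa>] assms(2,4) by (auto simp: ccod_frame)
  have "\<exists>!\<psi>''. cart_factor X \<kappa> (cleft X \<psi>) (cright X \<psi>) (ccomp X \<kappa> (cleft X \<psi>) [\<psi>]) \<psi>''"
    using assms(1,2,4) \<kappa> fr by (auto simp: cartesian_def)
  moreover have "cart_factor X \<kappa> (cleft X \<psi>) (cright X \<psi>) (ccomp X \<kappa> (cleft X \<psi>) [\<psi>]) \<psi>"
      "cart_factor X \<kappa> (cleft X \<psi>) (cright X \<psi>) (ccomp X \<kappa> (cleft X \<psi>) [\<psi>]) \<psi>'"
    using assms \<kappa> fr by (auto simp: cart_factor_def)
  ultimately show ?thesis by blast
qed

end

section \<open>Loose-identities and hom loose-cells\<close>

context virtual_equipment
begin

lemma lid_cell_simps [simp]: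
  assumes "A \<in> Obj X"
  shows "opcartesian X (lid_cell X A)" "lid_cell X A \<in> Cell X" "cdom X (lid_cell X A) = []"
    "ccod X (lid_cell X A) = lid X A" "cleft X (lid_cell X A) = tid X A"
    "cright X (lid_cell X A) = tid X A"
    "lid X A \<in> Loose X" "ltgt X (lid X A) = A" "lsrc X (lid X A) = A"
proof -
  have "is_loose_identity X A (lid_cell X A)"
    unfolding lid_cell_def using loose_identities[OF assms] by (rule someI_ex)
  then show "opcartesian X (lid_cell X A)" "lid_cell X A \<in> Cell X" "cdom X (lid_cell X A) = []"
    "ccod X (lid_cell X A) = lid X A" "cleft X (lid_cell X A) = tid X A"
    "cright X (lid_cell X A) = tid X A"
    "lid X A \<in> Loose X" "ltgt X (lid X A) = A" "lsrc X (lid X A) = A"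
    by (auto simp: is_loose_identity_def lid_def opcartesian_def gcell_def loose_cell_def)
qed

lemma hom_cell_simps [simp]:
  assumes "f \<in> Tight X" and "g \<in> Tight X" and "tcod X g = tcod X f"
  shows "cartesian X (hom_cell X f g)" "hom_cell X f g \<in> Cell X"
    "cdom X (hom_cell X f g) = [hom X f g]" "ccod X (hom_cell X f g) = lid X (tcod X f)"
    "cleft X (hom_cell X f g) = f" "cright X (hom_cell X f g) = g"
    "hom X f g \<in> Loose X" "ltgt X (hom X f g) = tdom X f" "lsrc X (hom X f g) = tdom X g"
proof -
  have "is_restriction X (lid X (tcod X f)) f g (hom_cell X f g)"
    unfolding hom_cell_def
    by (rule someI_ex, rule restrictions) (use assms in \<open>auto simp: loose_cell_def tight_cell_def\<close>)
  then show *: "cartesian X (hom_cell X f g)" "hom_cell X f g \<in> Cell X"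
    "cdom X (hom_cell X f g) = [hom X f g]" "ccod X (hom_cell X f g) = lid X (tcod X f)"
    "cleft X (hom_cell X f g) = f" "cright X (hom_cell X f g) = g"
    by (auto simp: is_restriction_def cartesian_def hom_def length_Suc_conv)
  show "hom X f g \<in> Loose X" "ltgt X (hom X f g) = tdom X f" "lsrc X (hom X f g) = tdom X g"
    using cell_dom[OF *(2)] * by auto
qed

text \<open>
  All equations between 2-cells into \<open>E(f,g)\<close> are checked after composing with the cartesian 2-cell
  into \<open>E(1,1)\<close>, where \<open>lid_mult\<close> and \<open>lid_cell\<close> give a strict monoid structure.
\<close>

definition flat :: "'t \<Rightarrow> 't \<Rightarrow> 'c \<Rightarrow> 'c" where
  "flat f g \<psi> = ccomp X (hom_cell X f g) (cleft X \<psi>) [\<psi>]"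

text \<open>The flat form of the identity 2-cell of \<open>f\<close>: the unit of the loose-identity
  precomposed with \<open>f\<close>, so that both its tight-cells are \<open>f\<close>.\<close>

definition hunit :: "'t \<Rightarrow> 'c" where
  "hunit f = ccomp X (lid_cell X (tcod X f)) f []"

text \<open>For nullary cells this is composition of 2-cells between tight-cells: left
  \<open>f\<close> and right \<open>g\<close>, followed by left \<open>g\<close> and right
  \<open>h\<close>.\<close>

definition hmul :: "'o \<Rightarrow> 'c \<Rightarrow> 'c \<Rightarrow> 'c" where
  "hmul E \<phi> \<psi> = ccomp X (lid_mult X E) (cleft X \<phi>) [\<phi>, \<psi>]"

lemma flat_simps [simp]:
  assumes "f \<in> Tight X" and "g \<in> Tight X" and "tcod X g = tcod X f"
    and "\<psi> \<in> Cell X" and "ccod X \<psi> = hom X f g"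
  shows "flat f g \<psi> \<in> Cell X" "cdom X (flat f g \<psi>) = cdom X \<psi>"
    "ccod X (flat f g \<psi>) = lid X (tcod X f)"
    "cleft X (flat f g \<psi>) = tcomp X f (cleft X \<psi>)" "cright X (flat f g \<psi>) = tcomp X g (cright X \<psi>)"
    "tcod X (cleft X \<psi>) = tdom X f" "tcod X (cright X \<psi>) = tdom X g"
proof -
  show *: "tcod X (cleft X \<psi>) = tdom X f" "tcod X (cright X \<psi>) = tdom X g"
    using assms ccod_frame[of \<psi>] by auto
  show "flat f g \<psi> \<in> Cell X" "cdom X (flat f g \<psi>) = cdom X \<psi>"
    "ccod X (flat f g \<psi>) = lid X (tcod X f)"
    "cleft X (flat f g \<psi>) = tcomp X f (cleft X \<psi>)" "cright X (flat f g \<psi>) = tcomp X g (cright X \<psi>)"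
    using assms * by (auto simp: flat_def)
qed

text \<open>Associativity with \<open>hom_cell\<close> outermost: flattening acts only on the
  codomain, so it commutes with precomposition.\<close>

lemma flat_ccomp:
  assumes "f \<in> Tight X" and "g \<in> Tight X" and "tcod X g = tcod X f"
    and "\<psi> \<in> Cell X" and "ccod X \<psi> = hom X f g"
    and "juxt X h \<chi>s k" and "map (ccod X) \<chi>s = cdom X \<psi>" and "tcod X h = tdom X (cleft X \<psi>)"
  shows "flat f g (ccomp X \<psi> h \<chi>s) = ccomp X (flat f g \<psi>) h \<chi>s"
proof -
  have "composable X (hom_cell X f g) (cleft X \<psi>) [\<psi>] (cright X \<psi>)"
    using assms flat_simps[of f g \<psi>] by (auto simp: composable_def)
  from ccomp_assoc[OF this, of h "[\<chi>s]" k] show ?thesis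
    using assms by (simp add: flat_def)
qed

lemma flat_cancel:
  assumes "f \<in> Tight X" and "g \<in> Tight X" and "tcod X g = tcod X f"
    and "\<psi> \<in> Cell X" and "\<psi>' \<in> Cell X" and "ccod X \<psi> = hom X f g" and "ccod X \<psi>' = hom X f g"
    and "cdom X \<psi>' = cdom X \<psi>" and "cleft X \<psi>' = cleft X \<psi>" and "cright X \<psi>' = cright X \<psi>"
    and "flat f g \<psi> = flat f g \<psi>'"
  shows "\<psi> = \<psi>'"
  by (rule cartesian_cancel[of "hom_cell X f g"]) (use assms in \<open>auto simp: flat_def\<close>)

text \<open>The existence half of cartesianness, \<open>flat_cancel\<close> being the uniqueness
  half. Prescribing the flat form is how the auxiliary cells \<open>u\<close>, \<open>v\<close>,
  \<open>n\<close>, \<open>m\<close> and the 2-cell \<open>\<pi>\<close> are obtained below.\<close>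

lemma flat_lift:
  assumes "f \<in> Tight X" and "g \<in> Tight X" and "tcod X g = tcod X f"
    and "\<theta> \<in> Cell X" and "ccod X \<theta> = lid X (tcod X f)"
    and "a \<in> Tight X" and "tcod X a = tdom X f" and "cleft X \<theta> = tcomp X f a"
    and "b \<in> Tight X" and "tcod X b = tdom X g" and "cright X \<theta> = tcomp X g b"
  obtains \<psi> where "\<psi> \<in> Cell X" "cdom X \<psi> = cdom X \<theta>" "ccod X \<psi> = hom X f g"
    "cleft X \<psi> = a" "cright X \<psi> = b" "flat f g \<psi> = \<theta>"
proof -
  have "\<exists>\<psi>. cart_factor X (hom_cell X f g) a b \<theta> \<psi>"
    using assms hom_cell_simps(1)[OF assms(1-3)] unfolding cartesian_def by (metis hom_cell_simps(4-6))
  then show ?thesis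
    using that assms by (auto simp: cart_factor_def flat_def)
qed

lemma flat_cid:
  assumes "f \<in> Tight X" and "g \<in> Tight X" and "tcod X g = tcod X f"
  shows "flat f g (cid X (hom X f g)) = hom_cell X f g"
  using assms ccomp_cid[of "hom_cell X f g"] by (simp add: flat_def)

lemma hunit_simps [simp]:
  assumes "f \<in> Tight X"
  shows "hunit f \<in> Cell X" "cdom X (hunit f) = []" "ccod X (hunit f) = lid X (tcod X f)"
    "cleft X (hunit f) = f" "cright X (hunit f) = f"
  using assms ccomp_simps[of "lid_cell X (tcod X f)" f "[]" f] by (auto simp: hunit_def)

section \<open>The monoid structure on a loose-identity\<close>

text \<open>The last equation is the left unit law, which defines \<open>lid_mult\<close> by
  opcartesianness. The right unit law and associativity are derived from it.\<close>

lemma lid_mult_simps [simp]: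
  assumes "E \<in> Obj X"
  shows "lid_mult X E \<in> Cell X" "cdom X (lid_mult X E) = [lid X E, lid X E]"
    "ccod X (lid_mult X E) = lid X E" "cleft X (lid_mult X E) = tid X E"
    "cright X (lid_mult X E) = tid X E"
    "ccomp X (lid_mult X E) (tid X E) [lid_cell X E, cid X (lid X E)] = cid X (lid X E)"
proof -
  have "\<exists>!\<mu>. opcart_factor X (lid_cell X E) [] [lid X E] (cid X (lid X E)) \<mu>"
    using assms lid_cell_simps(1)[OF assms] unfolding opcartesian_def by auto
  then have "opcart_factor X (lid_cell X E) [] [lid X E] (cid X (lid X E)) (lid_mult X E)"
    unfolding lid_mult_def by (rule theI')
  then show "lid_mult X E \<in> Cell X" "cdom X (lid_mult X E) = [lid X E, lid X E]"
    "ccod X (lid_mult X E) = lid X E" "cleft X (lid_mult X E) = tid X E"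
    "cright X (lid_mult X E) = tid X E"
    "ccomp X (lid_mult X E) (tid X E) [lid_cell X E, cid X (lid X E)] = cid X (lid X E)"
    using assms by (auto simp: opcart_factor_def gcomp_def)
qed

lemma tcod_cell_lid:
  assumes "\<phi> \<in> Cell X" and "ccod X \<phi> = lid X E" and "E \<in> Obj X"
  shows "tcod X (cleft X \<phi>) = E" "tcod X (cright X \<phi>) = E"
  using ccod_frame[OF assms(1)] assms(2,3) by auto

lemma hmul_simps [simp]:
  assumes "E \<in> Obj X" and "\<phi> \<in> Cell X" and "\<psi> \<in> Cell X" and "ccod X \<phi> = lid X E"
    and "ccod X \<psi> = lid X E" and "cright X \<phi> = cleft X \<psi>"
  shows "hmul E \<phi> \<psi> \<in> Cell X" "cdom X (hmul E \<phi> \<psi>) = cdom X \<phi> @ cdom X \<psi>"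
    "ccod X (hmul E \<phi> \<psi>) = lid X E" "cleft X (hmul E \<phi> \<psi>) = cleft X \<phi>"
    "cright X (hmul E \<phi> \<psi>) = cright X \<psi>"
  using assms tcod_cell_lid[of \<phi> E] tcod_cell_lid[of \<psi> E]
    ccomp_simps[of "lid_mult X E" "cleft X \<phi>" "[\<phi>, \<psi>]" "cright X \<psi>"]
  by (auto simp: hmul_def)

text \<open>Interchange, from associativity with two blocks. The tight-cell \<open>k\<close> at the
  seam is the only link between the factors.\<close>

lemma hmul_ccomp:
  assumes "E \<in> Obj X" and "\<phi> \<in> Cell X" and "\<psi> \<in> Cell X" and "ccod X \<phi> = lid X E"
    and "ccod X \<psi> = lid X E" and "cright X \<phi> = cleft X \<psi>"
    and "juxt X h \<chi>s k" and "map (ccod X) \<chi>s = cdom X \<phi>"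
    and "juxt X k \<chi>s' k'" and "map (ccod X) \<chi>s' = cdom X \<psi>"
    and "tcod X h = tdom X (cleft X \<phi>)"
  shows "ccomp X (hmul E \<phi> \<psi>) h (\<chi>s @ \<chi>s') = hmul E (ccomp X \<phi> h \<chi>s) (ccomp X \<psi> k \<chi>s')"
proof -
  have "composable X (lid_mult X E) (cleft X \<phi>) [\<phi>, \<psi>] (cright X \<psi>)"
    using assms tcod_cell_lid[of \<phi> E] by (auto simp: composable_def)
  moreover have "juxt X h (concat [\<chi>s, \<chi>s']) k'"
    using assms by (auto simp: juxt_append)
  ultimately show ?thesis
    using ccomp_assoc[of "lid_mult X E" "cleft X \<phi>" "[\<phi>, \<psi>]" "cright X \<psi>" h "[\<chi>s, \<chi>s']" k']
      juxt_rightmost[OF assms(7)] assms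
    by (simp add: hmul_def)
qed

lemma hmul_hunit_left:
  assumes "E \<in> Obj X" and "\<phi> \<in> Cell X" and "ccod X \<phi> = lid X E" and "cleft X \<phi> = f"
  shows "hmul E (hunit f) \<phi> = \<phi>"
proof -
  have f: "f \<in> Tight X" "tcod X f = E"
    using assms tcod_cell_lid by auto
  have "composable X (lid_mult X E) (tid X E) [lid_cell X E, cid X (lid X E)] (tid X E)"
    using assms by (auto simp: composable_def)
  from ccomp_assoc[OF this, of f "[[], [\<phi>]]" "cright X \<phi>"] show ?thesis
    using assms f cid_ccomp[of \<phi>] by (simp add: hmul_def hunit_def)
qed

text \<open>Both sides are cells out of one loose-identity, so it suffices to compare them on its
  unit. There the left-hand side is the product of the unit with itself, which the left unit law
  evaluates.\<close>

lemma lid_mult_hunit_right: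
  assumes "E \<in> Obj X"
  shows "ccomp X (lid_mult X E) (tid X E) [cid X (lid X E), lid_cell X E] = cid X (lid X E)"
    (is "?L = _")
proof (rule opcartesian_cancel[of "lid_cell X E" _ _ "[]" "[]"])
  have *: "composable X (lid_mult X E) (tid X E) [cid X (lid X E), lid_cell X E] (tid X E)"
    using assms by (auto simp: composable_def)
  show L: "?L \<in> Cell X" "cdom X ?L = [] @ [ccod X (lid_cell X E)] @ []"
    "cdom X (cid X (lid X E)) = cdom X ?L" "ccod X (cid X (lid X E)) = ccod X ?L"
    "cleft X (cid X (lid X E)) = cleft X ?L" "cright X (cid X (lid X E)) = cright X ?L"
    using ccomp[OF *] assms by auto
  have e: "ccomp X (lid_cell X E) (tid X E) [] = lid_cell X E"
    using ccomp_cid[of "lid_cell X E"] assms by simp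
  have "ccomp X ?L (tid X E) [lid_cell X E] = hmul E (lid_cell X E) (lid_cell X E)"
    using ccomp_assoc[OF *, of "tid X E" "[[lid_cell X E], []]" "tid X E"] e
      cid_ccomp[of "lid_cell X E"] assms
    by (simp add: hmul_def)
  also have "\<dots> = lid_cell X E"
    using hmul_hunit_left[of E "lid_cell X E" "tid X E"] e assms by (simp add: hunit_def)
  finally show "ccomp X ?L (tid X (tdom X (cleft X ?L))) (map (cid X) [] @ [lid_cell X E] @ map (cid X) []) =
    ccomp X (cid X (lid X E)) (tid X (tdom X (cleft X ?L))) (map (cid X) [] @ [lid_cell X E] @ map (cid X) [])"
    using L(5) assms cid_ccomp[of "lid_cell X E"] by simp
qed (use assms in auto)

lemma hmul_hunit_right:
  assumes "E \<in> Obj X" and "\<phi> \<in> Cell X" and "ccod X \<phi> = lid X E" and "cright X \<phi> = g"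
  shows "hmul E \<phi> (hunit g) = \<phi>"
proof -
  have "composable X (lid_mult X E) (tid X E) [cid X (lid X E), lid_cell X E] (tid X E)"
    using assms by (auto simp: composable_def)
  from ccomp_assoc[OF this, of "cleft X \<phi>" "[[\<phi>], []]" g] show ?thesis
    using assms tcod_cell_lid[of \<phi> E] cid_ccomp[of \<phi>] lid_mult_hunit_right
    by (auto simp add: hmul_def hunit_def)
qed

text \<open>Inserting the unit in the first slot reduces both bracketings to \<open>lid_mult\<close>
  by the left unit law.\<close>

lemma lid_mult_assoc:
  assumes "E \<in> Obj X"
  shows "hmul E (lid_mult X E) (cid X (lid X E)) = hmul E (cid X (lid X E)) (lid_mult X E)"
    (is "?L = ?R")
proof (rule opcartesian_cancel[of "lid_cell X E" _ _ "[]" "[lid X E, lid X E]"])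
  let ?U = "cid X (lid X E)"
  have e: "lid_cell X E = hunit (tid X E)"
    using ccomp_cid[of "lid_cell X E"] assms by (simp add: hunit_def)
  have "ccomp X ?L (tid X E) [lid_cell X E, ?U, ?U] =
      hmul E (ccomp X (lid_mult X E) (tid X E) [lid_cell X E, ?U]) (ccomp X ?U (tid X E) [?U])"
    using hmul_ccomp[of E "lid_mult X E" ?U "tid X E" "[lid_cell X E, ?U]" "tid X E" "[?U]"] assms
    by simp
  also have "\<dots> = hmul E ?U ?U"
    using assms cid_ccomp[of ?U] by simp
  also have "\<dots> = lid_mult X E"
    using ccomp_cid[of "lid_mult X E"] assms by (simp add: hmul_def)
  finally have L: "ccomp X ?L (tid X E) [lid_cell X E, ?U, ?U] = lid_mult X E" .
  have "ccomp X ?R (tid X E) [lid_cell X E, ?U, ?U] =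
      hmul E (ccomp X ?U (tid X E) [lid_cell X E]) (ccomp X (lid_mult X E) (tid X E) [?U, ?U])"
    using hmul_ccomp[of E ?U "lid_mult X E" "tid X E" "[lid_cell X E]" "tid X E" "[?U, ?U]"] assms
    by simp
  also have "\<dots> = hmul E (hunit (tid X E)) (lid_mult X E)"
    using assms cid_ccomp[of "lid_cell X E"] ccomp_cid[of "lid_mult X E"] e by simp
  also have "\<dots> = lid_mult X E"
    by (rule hmul_hunit_left) (use assms in auto)
  finally show "ccomp X ?L (tid X (tdom X (cleft X ?L)))
        (map (cid X) [] @ [lid_cell X E] @ map (cid X) [lid X E, lid X E]) =
    ccomp X ?R (tid X (tdom X (cleft X ?L)))
        (map (cid X) [] @ [lid_cell X E] @ map (cid X) [lid X E, lid X E])"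
    using L assms by simp
qed (use assms in auto)

lemma hmul_assoc:
  assumes "E \<in> Obj X" and "\<phi> \<in> Cell X" and "\<psi> \<in> Cell X" and "\<chi> \<in> Cell X"
    and "ccod X \<phi> = lid X E" and "ccod X \<psi> = lid X E" and "ccod X \<chi> = lid X E"
    and "cright X \<phi> = cleft X \<psi>" and "cright X \<psi> = cleft X \<chi>"
  shows "hmul E (hmul E \<phi> \<psi>) \<chi> = hmul E \<phi> (hmul E \<psi> \<chi>)"
proof -
  let ?U = "cid X (lid X E)"
  have fr: "tcod X (cleft X \<phi>) = E" "tcod X (cleft X \<psi>) = E" "tcod X (cleft X \<chi>) = E"
    using assms tcod_cell_lid by auto
  have "hmul E (hmul E \<phi> \<psi>) \<chi> = ccomp X (hmul E (lid_mult X E) ?U) (cleft X \<phi>) [\<phi>, \<psi>, \<chi>]"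
    using hmul_ccomp[of E "lid_mult X E" ?U "cleft X \<phi>" "[\<phi>, \<psi>]" "cright X \<psi>" "[\<chi>]" "cright X \<chi>"]
      assms fr cid_ccomp[of \<chi>] by (simp add: hmul_def[of E \<phi> \<psi>])
  also have "\<dots> = hmul E \<phi> (hmul E \<psi> \<chi>)"
    using hmul_ccomp[of E ?U "lid_mult X E" "cleft X \<phi>" "[\<phi>]" "cright X \<phi>" "[\<psi>, \<chi>]" "cright X \<chi>"]
      assms fr cid_ccomp[of \<phi>] by (simp add: hmul_def[of E \<psi> \<chi>] lid_mult_assoc)
  finally show ?thesis .
qed

section \<open>Restrictions, counits and units in flat form\<close>

text \<open>The last equation is the gain from flattening: the comparison between iterated and
  single restriction becomes the chosen cartesian cell of the composite tight-cells.\<close>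

lemma hom_restr_simps:
  assumes "f \<in> Tight X" and "g \<in> Tight X" and "tcod X g = tcod X f"
    and "h \<in> Tight X" and "tcod X h = tdom X f" and "k \<in> Tight X" and "tcod X k = tdom X g"
  shows "hom_restr X f g h k \<in> Cell X"
    "cdom X (hom_restr X f g h k) = [hom X (tcomp X f h) (tcomp X g k)]"
    "ccod X (hom_restr X f g h k) = hom X f g" "cleft X (hom_restr X f g h k) = h"
    "cright X (hom_restr X f g h k) = k"
    "flat f g (hom_restr X f g h k) = hom_cell X (tcomp X f h) (tcomp X g k)"
proof -
  have "\<exists>!\<rho>. cart_factor X (hom_cell X f g) h k (hom_cell X (tcomp X f h) (tcomp X g k)) \<rho>"
    using hom_cell_simps(1)[OF assms(1-3)] assms unfolding cartesian_def by simp
  then have "cart_factor X (hom_cell X f g) h k (hom_cell X (tcomp X f h) (tcomp X g k))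
      (hom_restr X f g h k)"
    unfolding hom_restr_def by (rule theI')
  then show "hom_restr X f g h k \<in> Cell X"
    "cdom X (hom_restr X f g h k) = [hom X (tcomp X f h) (tcomp X g k)]"
    "ccod X (hom_restr X f g h k) = hom X f g" "cleft X (hom_restr X f g h k) = h"
    "cright X (hom_restr X f g h k) = k"
    "flat f g (hom_restr X f g h k) = hom_cell X (tcomp X f h) (tcomp X g k)"
    using assms by (auto simp: cart_factor_def flat_def)
qed

text \<open>Shows that the description in \<open>restrict_cell\<close> denotes:
  \<open>\<phi>\<close> composed with \<open>\<kappa>s\<close> has a frame that factors through
  \<open>\<kappa>\<close> with identity tight-cells.\<close>

lemma restrict_cell_cartesian:
  assumes "cartesian X \<kappa>" and "cdom X \<kappa> = [q]" and "\<phi> \<in> Cell X"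
    and "juxt X (cleft X \<kappa>) \<kappa>s (cright X \<kappa>)" and "map (ccod X) \<kappa>s = cdom X \<phi>"
    and "ccod X \<phi> = ccod X \<kappa>"
    and "cleft X \<phi> = tid X (tcod X (cleft X \<kappa>))" and "cright X \<phi> = tid X (tcod X (cright X \<kappa>))"
  shows "gcell X (restrict_cell X \<phi> \<kappa>s \<kappa>) (concat (map (cdom X) \<kappa>s)) q"
    "ccomp X \<kappa> (tid X (ltgt X q)) [restrict_cell X \<phi> \<kappa>s \<kappa>] = ccomp X \<phi> (cleft X \<kappa>) \<kappa>s"
proof -
  have \<kappa>: "\<kappa> \<in> Cell X"
    using assms(1) by (simp add: cartesian_def)
  have q: "tdom X (cleft X \<kappa>) = ltgt X q" "tdom X (cright X \<kappa>) = lsrc X q"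
    using cell_dom[OF \<kappa>] assms(2) by auto
  have "\<exists>!\<psi>. cart_factor X \<kappa> (tid X (tdom X (cleft X \<kappa>))) (tid X (tdom X (cright X \<kappa>)))
     (ccomp X \<phi> (cleft X \<kappa>) \<kappa>s) \<psi>"
    using assms \<kappa> ccomp_simps[of \<phi> "cleft X \<kappa>" \<kappa>s "cright X \<kappa>"]
    by (simp add: cartesian_def)
  then have "cart_factor X \<kappa> (tid X (tdom X (cleft X \<kappa>))) (tid X (tdom X (cright X \<kappa>)))
     (ccomp X \<phi> (cleft X \<kappa>) \<kappa>s) (restrict_cell X \<phi> \<kappa>s \<kappa>)"
    unfolding restrict_cell_def by (rule theI')
  then show "gcell X (restrict_cell X \<phi> \<kappa>s \<kappa>) (concat (map (cdom X) \<kappa>s)) q"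
    "ccomp X \<kappa> (tid X (ltgt X q)) [restrict_cell X \<phi> \<kappa>s \<kappa>] = ccomp X \<phi> (cleft X \<kappa>) \<kappa>s"
    using assms \<kappa> q ccomp_simps[of \<phi> "cleft X \<kappa>" \<kappa>s "cright X \<kappa>"]
    by (auto simp: cart_factor_def gcell_def)
qed

text \<open>\<open>smile\<close> is a product of two cartesian cells. Interchange sends one
  comparison cell into each factor, where flattening absorbs it.\<close>

lemma smile_at_simps:
  assumes "f \<in> Tight X" and "g \<in> Tight X" and "h \<in> Tight X"
    and "tcod X f = E" and "tcod X g = E" and "tcod X h = E"
  shows "gcell X (smile_at X f g h) [hom X g f, hom X f h] (hom X g h)"
    "flat g h (smile_at X f g h) = hmul E (hom_cell X g f) (hom_cell X f h)"
proof -
  have E: "E \<in> Obj X" using assms by auto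
  let ?\<rho>1 = "hom_restr X (tid X (tcod X f)) f g (tid X (tdom X f))"
  let ?\<rho>2 = "hom_restr X f (tid X (tcod X f)) (tid X (tdom X f)) h"
  let ?\<kappa>1 = "hom_cell X (tid X E) f" and ?\<kappa>2 = "hom_cell X f (tid X E)"
  have r1: "?\<rho>1 \<in> Cell X" "cdom X ?\<rho>1 = [hom X g f]" "ccod X ?\<rho>1 = hom X (tid X E) f"
      "cleft X ?\<rho>1 = g" "cright X ?\<rho>1 = tid X (tdom X f)" "flat (tid X E) f ?\<rho>1 = hom_cell X g f"
    using hom_restr_simps[of "tid X (tcod X f)" f g "tid X (tdom X f)"] assms E by simp_all
  have r2: "?\<rho>2 \<in> Cell X" "cdom X ?\<rho>2 = [hom X f h]" "ccod X ?\<rho>2 = hom X f (tid X E)"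
      "cleft X ?\<rho>2 = tid X (tdom X f)" "cright X ?\<rho>2 = h" "flat f (tid X E) ?\<rho>2 = hom_cell X f h"
    using hom_restr_simps[of f "tid X (tcod X f)" "tid X (tdom X f)" h] assms E by simp_all
  have sm: "smile X f = hmul E ?\<kappa>1 ?\<kappa>2"
    using assms E by (simp add: smile_def gcomp_def hmul_def)
  have \<kappa>: "?\<kappa>1 \<in> Cell X" "ccod X ?\<kappa>1 = lid X E" "cleft X ?\<kappa>1 = tid X E" "cright X ?\<kappa>1 = f"
      "cdom X ?\<kappa>1 = [hom X (tid X E) f]" "?\<kappa>2 \<in> Cell X" "ccod X ?\<kappa>2 = lid X E"
      "cleft X ?\<kappa>2 = f" "cright X ?\<kappa>2 = tid X E" "cdom X ?\<kappa>2 = [hom X f (tid X E)]"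
    using assms E by simp_all
  have gh: "cartesian X (hom_cell X g h)" "cdom X (hom_cell X g h) = [hom X g h]"
      "ccod X (hom_cell X g h) = lid X E" "cleft X (hom_cell X g h) = g" "cright X (hom_cell X g h) = h"
      "ltgt X (hom X g h) = tdom X g"
    using assms by simp_all
  have jx: "juxt X (cleft X (hom_cell X g h)) [?\<rho>1, ?\<rho>2] (cright X (hom_cell X g h))"
      "map (ccod X) [?\<rho>1, ?\<rho>2] = cdom X (smile X f)"
    using r1 r2 \<kappa> E assms(3) by (simp_all add: gh sm)
  have res: "gcell X (smile_at X f g h) (concat (map (cdom X) [?\<rho>1, ?\<rho>2])) (hom X g h)"
    "ccomp X (hom_cell X g h) (tid X (ltgt X (hom X g h))) [smile_at X f g h] =
      ccomp X (smile X f) (cleft X (hom_cell X g h)) [?\<rho>1, ?\<rho>2]"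
    unfolding smile_at_def
    by (rule restrict_cell_cartesian[OF gh(1,2) _ jx]; use \<kappa> E assms(5,6) in \<open>simp add: sm gh\<close>)+
  show g: "gcell X (smile_at X f g h) [hom X g f, hom X f h] (hom X g h)"
    using res(1) r1(2) r2(2) by simp
  have "ccomp X (smile X f) g ([?\<rho>1] @ [?\<rho>2]) =
      hmul E (ccomp X ?\<kappa>1 g [?\<rho>1]) (ccomp X ?\<kappa>2 (tid X (tdom X f)) [?\<rho>2])"
    unfolding sm
    by (rule hmul_ccomp[where k'=h]) (use assms(1,3,5) E r1(1-5) r2(1-5) \<kappa> in simp_all)
  then have "ccomp X (smile X f) g [?\<rho>1, ?\<rho>2] = hmul E (hom_cell X g f) (hom_cell X f h)"
    using r1(4,6) r2(4,6) by (simp add: flat_def)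
  moreover have "flat g h (smile_at X f g h) =
      ccomp X (hom_cell X g h) (tid X (ltgt X (hom X g h))) [smile_at X f g h]"
    using g by (simp add: flat_def gcell_def)
  ultimately show "flat g h (smile_at X f g h) = hmul E (hom_cell X g f) (hom_cell X f h)"
    by (simp only: res(2) gh(4))
qed

text \<open>The rule by which counits disappear from later arguments: interchange applied to the
  flat form of \<open>smile_at\<close>.\<close>

lemma flat_smile_at:
  assumes "f \<in> Tight X" and "g \<in> Tight X" and "h \<in> Tight X"
    and "tcod X f = E" and "tcod X g = E" and "tcod X h = E"
    and "\<phi> \<in> Cell X" and "ccod X \<phi> = hom X g f" and "\<psi> \<in> Cell X" and "ccod X \<psi> = hom X f h"
    and "cright X \<phi> = cleft X \<psi>" and "cleft X \<phi> = a"
  shows "flat g h (ccomp X (smile_at X f g h) a [\<phi>, \<psi>]) = hmul E (flat g f \<phi>) (flat f h \<psi>)"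
proof -
  have E: "E \<in> Obj X" using assms by auto
  note s = smile_at_simps[OF assms(1-6)]
  have a: "a \<in> Tight X" "tcod X a = tdom X g"
    using assms(2,5,4,1,7,8,12) flat_simps(6)[of g f \<phi>] by auto
  have "flat g h (ccomp X (smile_at X f g h) a [\<phi>, \<psi>]) = ccomp X (flat g h (smile_at X f g h)) a [\<phi>, \<psi>]"
    by (rule flat_ccomp[where k="cright X \<psi>"]) (use assms a s(1) in \<open>auto simp: gcell_def\<close>)
  also have "\<dots> = hmul E (flat g f \<phi>) (flat f h \<psi>)"
    using hmul_ccomp[of E "hom_cell X g f" "hom_cell X f h" a "[\<phi>]" "cright X \<phi>" "[\<psi>]" "cright X \<psi>"]
      s(2) assms a E by (simp add: flat_def)
  finally show ?thesis .
qed

lemma frown_simps [simp]: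
  assumes "f \<in> Tight X"
  shows "frown X f \<in> Cell X" "cdom X (frown X f) = []" "ccod X (frown X f) = hom X f f"
    "cleft X (frown X f) = tid X (tdom X f)" "cright X (frown X f) = tid X (tdom X f)"
    "flat f f (frown X f) = hunit f"
proof -
  have "\<exists>!\<phi>. cart_factor X (hom_cell X f f) (tid X (tdom X f)) (tid X (tdom X f)) (hunit f) \<phi>"
    using hom_cell_simps(1)[of f f] assms unfolding cartesian_def by simp
  then have "cart_factor X (hom_cell X f f) (tid X (tdom X f)) (tid X (tdom X f)) (hunit f) (frown X f)"
    unfolding frown_def hunit_def by (rule theI')
  then show "frown X f \<in> Cell X" "cdom X (frown X f) = []" "ccod X (frown X f) = hom X f f"
    "cleft X (frown X f) = tid X (tdom X f)" "cright X (frown X f) = tid X (tdom X f)"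
    "flat f f (frown X f) = hunit f"
    using assms by (auto simp: cart_factor_def flat_def)
qed

text \<open>The action \<open>A(1,1) \<Rightarrow> B(1,1)\<close> of a tight-cell on loose-identities\<close>

definition hfun :: "'t \<Rightarrow> 'c" where
  "hfun f = flat f f (frown1 X f)"

lemma frown1_simps [simp]:
  assumes "f \<in> Tight X"
  shows "frown1 X f \<in> Cell X" "cdom X (frown1 X f) = [lid X (tdom X f)]"
    "ccod X (frown1 X f) = hom X f f"
    "cleft X (frown1 X f) = tid X (tdom X f)" "cright X (frown1 X f) = tid X (tdom X f)"
    "ccomp X (frown1 X f) (tid X (tdom X f)) [lid_cell X (tdom X f)] = frown X f"
proof -
  have "\<exists>!\<phi>. opcart_factor X (lid_cell X (tdom X f)) [] [] (frown X f) \<phi>"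
    using lid_cell_simps(1)[of "tdom X f"] assms unfolding opcartesian_def by simp
  then have "opcart_factor X (lid_cell X (tdom X f)) [] [] (frown X f) (frown1 X f)"
    unfolding frown1_def by (rule theI')
  then show "frown1 X f \<in> Cell X" "cdom X (frown1 X f) = [lid X (tdom X f)]"
    "ccod X (frown1 X f) = hom X f f"
    "cleft X (frown1 X f) = tid X (tdom X f)" "cright X (frown1 X f) = tid X (tdom X f)"
    "ccomp X (frown1 X f) (tid X (tdom X f)) [lid_cell X (tdom X f)] = frown X f"
    using assms by (auto simp: opcart_factor_def gcomp_def)
qed

lemma hfun_simps [simp]:
  assumes "f \<in> Tight X"
  shows "hfun f \<in> Cell X" "cdom X (hfun f) = [lid X (tdom X f)]" "ccod X (hfun f) = lid X (tcod X f)"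
    "cleft X (hfun f) = f" "cright X (hfun f) = f"
    "ccomp X (hfun f) (tid X (tdom X f)) [lid_cell X (tdom X f)] = hunit f"
proof -
  show "hfun f \<in> Cell X" "cdom X (hfun f) = [lid X (tdom X f)]" "ccod X (hfun f) = lid X (tcod X f)"
    "cleft X (hfun f) = f" "cright X (hfun f) = f"
    using assms by (auto simp: hfun_def)
  show "ccomp X (hfun f) (tid X (tdom X f)) [lid_cell X (tdom X f)] = hunit f"
    using flat_ccomp[of f f "frown1 X f" "tid X (tdom X f)" "[lid_cell X (tdom X f)]" "tid X (tdom X f)"]
      assms by (simp add: hfun_def)
qed

text \<open>Pasting for cartesian cells: \<open>hom_cell\<close> of the composites is
  \<open>hom_cell X f g\<close> after \<open>hom_restr\<close>, and both \<open>hom_cell\<close>s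
  are cartesian. The result serves \<open>frown_at\<close>, which is defined by factoring through a
  \<open>hom_restr\<close>.\<close>

lemma hom_restr_cartesian:
  assumes "f \<in> Tight X" and "g \<in> Tight X" and "tcod X g = tcod X f"
    and "h \<in> Tight X" and "tcod X h = tdom X f" and "k \<in> Tight X" and "tcod X k = tdom X g"
  shows "cartesian X (hom_restr X f g h k)"
  unfolding cartesian_def
proof (intro conjI allI impI)
  note r = hom_restr_simps[OF assms]
  let ?\<rho> = "hom_restr X f g h k" and ?fh = "tcomp X f h" and ?gk = "tcomp X g k"
  show "?\<rho> \<in> Cell X" "length (cdom X ?\<rho>) = 1"
    using r by auto
  have flat_r: "flat ?fh ?gk \<psi> = flat f g (ccomp X ?\<rho> a [\<psi>])"
    if "\<psi> \<in> Cell X" "ccod X \<psi> = hom X ?fh ?gk" "cleft X \<psi> = a" for \<psi> a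
    using flat_ccomp[of f g ?\<rho> a "[\<psi>]" "cright X \<psi>"] that r assms flat_simps(6)[of ?fh ?gk \<psi>]
    by (simp add: flat_def[of ?fh ?gk])
  fix \<theta> a b
  assume \<theta>: "\<theta> \<in> Cell X \<and> ccod X \<theta> = ccod X ?\<rho> \<and> a \<in> Tight X \<and> tcod X a = tdom X (cleft X ?\<rho>) \<and>
    cleft X \<theta> = tcomp X (cleft X ?\<rho>) a \<and> b \<in> Tight X \<and> tcod X b = tdom X (cright X ?\<rho>) \<and>
    cright X \<theta> = tcomp X (cright X ?\<rho>) b"
  \<comment> \<open>Reassociating lets the frame of \<open>flat f g \<theta>\<close> be read over
    \<open>f h\<close> and \<open>g k\<close>, so that it lifts directly to
    \<open>hom X ?fh ?gk\<close>.\<close>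
  have as: "tcomp X f (tcomp X h a) = tcomp X ?fh a" "tcomp X g (tcomp X k b) = tcomp X ?gk b"
    using tcomp_assoc[of a _ _ h _ f] tcomp_assoc[of b _ _ k _ g] \<theta> assms r
    by (auto simp: tight_cell_def)
  obtain \<psi> where \<psi>: "\<psi> \<in> Cell X" "cdom X \<psi> = cdom X \<theta>" "ccod X \<psi> = hom X ?fh ?gk"
      "cleft X \<psi> = a" "cright X \<psi> = b" "flat ?fh ?gk \<psi> = flat f g \<theta>"
    using flat_lift[of ?fh ?gk "flat f g \<theta>" a b] \<theta> assms r as by auto
  show "\<exists>!\<psi>. cart_factor X ?\<rho> a b \<theta> \<psi>"
  proof
    have "ccomp X ?\<rho> a [\<psi>] = \<theta>"
      by (rule flat_cancel[of f g]) (use \<psi> \<theta> assms r flat_r in auto)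
    then show "cart_factor X ?\<rho> a b \<theta> \<psi>"
      using \<psi> r by (simp add: cart_factor_def)
    fix \<psi>'
    assume "cart_factor X ?\<rho> a b \<theta> \<psi>'"
    then have \<psi>': "\<psi>' \<in> Cell X" "cdom X \<psi>' = cdom X \<theta>" "ccod X \<psi>' = hom X ?fh ?gk"
        "cleft X \<psi>' = a" "cright X \<psi>' = b" "ccomp X ?\<rho> a [\<psi>'] = \<theta>"
      using r(2) by (simp_all add: cart_factor_def)
    have "flat ?fh ?gk \<psi>' = flat ?fh ?gk \<psi>"
      using flat_r[OF \<psi>'(1,3,4)] \<psi>(6) \<psi>'(6) by simp
    show "\<psi>' = \<psi>"
      by (rule flat_cancel[of ?fh ?gk]) (use \<psi> \<psi>' assms \<open>flat ?fh ?gk \<psi>' = flat ?fh ?gk \<psi>\<close> in simp_all)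
  qed
qed

text \<open>Flattening over the composite \<open>g k\<close> is done in two stages, through
  \<open>hom_restr\<close> and then through \<open>hom_cell X g g\<close>. The first removes the
  restriction, the second turns \<open>frown1\<close> into \<open>hfun\<close>.\<close>

lemma frown_at_simps:
  assumes "g \<in> Tight X" and "k \<in> Tight X" and "tcod X k = tdom X g" and "tdom X g = Y"
  shows "gcell X (frown_at X g k) [hom X k (tid X Y)] (hom X (tcomp X g k) g)"
    "flat (tcomp X g k) g (frown_at X g k) = ccomp X (hfun g) k [hom_cell X k (tid X Y)]"
proof -
  let ?\<kappa> = "hom_cell X k (tid X Y)" and ?\<rho> = "hom_restr X g g k (tid X Y)"
  note r = hom_restr_simps[of g g k "tid X Y"]
  have Y: "Y \<in> Obj X" using assms by auto
  have gY: "tcomp X g (tid X Y) = g" using assms by simp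
  have res: "gcell X (frown_at X g k) (concat (map (cdom X) [?\<kappa>])) (hom X (tcomp X g k) g)"
    "ccomp X ?\<rho> (tid X (ltgt X (hom X (tcomp X g k) g))) [frown_at X g k] =
      ccomp X (frown1 X g) (cleft X ?\<rho>) [?\<kappa>]"
    unfolding frown_at_def assms(4)
    by (rule restrict_cell_cartesian; use assms Y gY r in \<open>auto intro!: hom_restr_cartesian\<close>)+
  show gc: "gcell X (frown_at X g k) [hom X k (tid X Y)] (hom X (tcomp X g k) g)"
    using res(1) assms Y by simp
  have fr: "frown_at X g k \<in> Cell X" "ccod X (frown_at X g k) = hom X (tcomp X g k) g"
      "cleft X (frown_at X g k) = tid X (tdom X k)"
      "cright X (frown_at X g k) = tid X Y"
    using gc assms Y by (auto simp: gcell_def)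
  have "flat (tcomp X g k) g (frown_at X g k) = ccomp X (flat g g ?\<rho>) (tid X (tdom X k)) [frown_at X g k]"
    using r fr assms Y by (simp add: flat_def[of "tcomp X g k"])
  also have "\<dots> = flat g g (ccomp X ?\<rho> (tid X (tdom X k)) [frown_at X g k])"
    using flat_ccomp[of g g ?\<rho> "tid X (tdom X k)" "[frown_at X g k]" "tid X Y"] fr r assms Y by simp
  also have "\<dots> = flat g g (ccomp X (frown1 X g) k [?\<kappa>])"
    using res(2) r assms Y by simp
  also have "\<dots> = ccomp X (hfun g) k [?\<kappa>]"
    using flat_ccomp[of g g "frown1 X g" k "[?\<kappa>]" "tid X Y"] assms Y by (simp add: hfun_def)
  finally show "flat (tcomp X g k) g (frown_at X g k) = ccomp X (hfun g) k [?\<kappa>]" .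
qed

section \<open>Relative adjunctions and left extensions\<close>

lemma ccomp_cids_right:
  "\<psi> \<in> Cell X \<Longrightarrow> cdom X \<psi> = ps \<Longrightarrow> tdom X (cleft X \<psi>) = A \<Longrightarrow> ccomp X \<psi> (tid X A) (map (cid X) ps) = \<psi>"
  using ccomp_cid[of \<psi>] by simp

lemma ccomp_cid_right:
  "\<psi> \<in> Cell X \<Longrightarrow> cdom X \<psi> = [p] \<Longrightarrow> tdom X (cleft X \<psi>) = A \<Longrightarrow> ccomp X \<psi> (tid X A) [cid X p] = \<psi>"
  using ccomp_cid[of \<psi>] by simp

lemma ccomp_cid_left:
  "\<phi> \<in> Cell X \<Longrightarrow> ccod X \<phi> = q \<Longrightarrow> cleft X \<phi> = f \<Longrightarrow> ccomp X (cid X q) f [\<phi>] = \<phi>"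
  using cid_ccomp[of \<phi>] by simp

lemma ccomp_assoc_unary:
  assumes "\<psi> \<in> Cell X" and "\<phi> \<in> Cell X" and "cdom X \<psi> = [ccod X \<phi>]" and "cleft X \<phi> = f"
    and "juxt X h \<chi>s k" and "map (ccod X) \<chi>s = cdom X \<phi>" and "tcod X h = tdom X f"
  shows "ccomp X (ccomp X \<psi> f [\<phi>]) h \<chi>s = ccomp X \<psi> (tcomp X f h) [ccomp X \<phi> h \<chi>s]"
proof -
  have "tcod X f = tdom X (cleft X \<psi>)"
    using cell_dom[OF assms(1)] assms(2-4) ccod_frame(1)[of \<phi>] by auto
  then have "composable X \<psi> f [\<phi>] (cright X \<phi>)"
    using assms by (auto simp: composable_def)
  from ccomp_assoc[OF this, of h "[\<chi>s]" k] show ?thesis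
    using assms by simp
qed

section \<open>Absoluteness as invertibility\<close>

lemma left_opcartesian_cancel:
  assumes "left_opcartesian X \<phi>" and "\<psi> \<in> Cell X" and "\<psi>' \<in> Cell X"
    and "cdom X \<psi> = [ccod X \<phi>]" and "cdom X \<psi>' = [ccod X \<phi>]" and "ccod X \<psi>' = ccod X \<psi>"
    and "cleft X \<phi> = tid X A" and "cleft X \<psi> = tid X A" and "cleft X \<psi>' = tid X A"
    and "cright X \<psi>' = cright X \<psi>" and "A \<in> Obj X"
    and "ccomp X \<psi> (tid X A) [\<phi>] = ccomp X \<psi>' (tid X A) [\<phi>]"
  shows "\<psi> = \<psi>'"
proof -
  define \<theta> where "\<theta> = ccomp X \<psi> (tid X A) [\<phi>]"
  have \<phi>: "\<phi> \<in> Cell X" "cright X \<phi> = tid X (lsrc X (ccod X \<phi>))"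
    using assms(1) by (auto simp: left_opcartesian_def gcell_def)
  have "lsrc X (ccod X \<phi>) = tdom X (cright X \<psi>)"
    using cell_dom[OF assms(2)] assms(4) by simp
  then have \<theta>: "\<theta> \<in> Cell X" "cdom X \<theta> = cdom X \<phi> @ []" "ccod X \<theta> = ccod X \<psi>"
      "cleft X \<theta> = cleft X \<phi>" "cright X \<theta> = cright X \<psi>"
    using assms \<phi> by (auto simp: \<theta>_def)
  then have "\<exists>!\<psi>. opcart_factor X \<phi> [] [] \<theta> \<psi>"
    using assms(1) by (auto simp: left_opcartesian_def)
  moreover have "opcart_factor X \<phi> [] [] \<theta> \<psi>" "opcart_factor X \<phi> [] [] \<theta> \<psi>'"
    using assms \<theta> by (auto simp: opcart_factor_def gcomp_def \<theta>_def)
  ultimately show ?thesis by blast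
qed

text \<open>The inverse arises by factoring twice: the identity of \<open>p\<close> through
  \<open>\<phi>\<close>, then the result through \<open>\<sigma>\<close>.\<close>

lemma left_opcartesian_imp_iso:
  assumes op: "opcartesian X \<phi>" and \<phi>: "gcell X \<phi> [] u"
    and lop: "left_opcartesian X \<sigma>" and \<sigma>: "gcell X \<sigma> [u, p] q"
  shows "iso_gcell X (gcomp X \<sigma> [\<phi>, cid X p]) p q"
proof -
  define A where "A = ltgt X q"
  define B where "B = lsrc X q"
  have s: "\<sigma> \<in> Cell X" "cdom X \<sigma> = [u, p]" "ccod X \<sigma> = q" "cleft X \<sigma> = tid X A" "cright X \<sigma> = tid X B"
    using \<sigma> by (auto simp: gcell_def A_def B_def)
  have q: "q \<in> Loose X" "A \<in> Obj X" "B \<in> Obj X" "ltgt X q = A" "lsrc X q = B"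
    using s cell_simps(3)[of \<sigma>] by (auto simp: A_def B_def)
  have up: "u \<in> Loose X" "ltgt X u = A" "p \<in> Loose X" "ltgt X p = lsrc X u" "lsrc X p = B"
    using cell_dom[OF s(1)] s q by auto
  have f: "\<phi> \<in> Cell X" "cdom X \<phi> = []" "ccod X \<phi> = u" "cleft X \<phi> = tid X A" "cright X \<phi> = tid X (lsrc X u)"
    using \<phi> up by (auto simp: gcell_def)
  have u: "lsrc X u = A"
    using cell_dom[OF f(1)] f up q by simp
  note [simp] = s q up f u
  let ?\<alpha> = "ccomp X \<sigma> (tid X A) [\<phi>, cid X p]"
  have al: "?\<alpha> \<in> Cell X" "cdom X ?\<alpha> = [p]" "ccod X ?\<alpha> = q" "cleft X ?\<alpha> = tid X A" "cright X ?\<alpha> = tid X B"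
    by simp_all
  \<comment> \<open>\<open>\<theta>\<close> is the left action of \<open>u\<close> on
    \<open>p\<close> that becomes trivial when the unit \<open>\<phi>\<close> is inserted.\<close>
  have "\<exists>\<theta>. opcart_factor X \<phi> [] [p] (cid X p) \<theta>"
    by (rule ex1_implies_ex, rule op[unfolded opcartesian_def, THEN conjunct2, rule_format]) simp
  then obtain \<theta> where t: "\<theta> \<in> Cell X" "cdom X \<theta> = [u, p]" "ccod X \<theta> = p" "cleft X \<theta> = tid X A"
      "cright X \<theta> = tid X B" "ccomp X \<theta> (tid X A) [\<phi>, cid X p] = cid X p"
    by (auto simp: opcart_factor_def gcomp_def)
  note [simp] = t(1-5)
  have "\<exists>\<psi>. opcart_factor X \<sigma> [] [] \<theta> \<psi>"
    by (rule ex1_implies_ex, rule lop[unfolded left_opcartesian_def, THEN conjunct2, rule_format]) simp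
  then obtain \<psi> where psi: "\<psi> \<in> Cell X" "cdom X \<psi> = [q]" "ccod X \<psi> = p" "cleft X \<psi> = tid X A"
      "cright X \<psi> = tid X B" "ccomp X \<psi> (tid X A) [\<sigma>] = \<theta>"
    by (auto simp: opcart_factor_def gcomp_def)
  note [simp] = psi(1-5)
  have 1: "ccomp X \<psi> (tid X A) [?\<alpha>] = cid X p"
    using ccomp_assoc_unary[of \<psi> \<sigma> "tid X A" "tid X A" "[\<phi>, cid X p]" "tid X B"] t(6) psi(6) by simp
  \<comment> \<open>Inserting \<open>\<phi>\<close> turns both sides into \<open>?\<alpha>\<close>,
    and \<open>\<phi>\<close> can be cancelled.\<close>
  have "ccomp X ?\<alpha> (tid X A) [\<theta>] = \<sigma>"
  proof (rule opcartesian_cancel[OF op, of _ _ "[]" "[p]"])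
    have "ccomp X (ccomp X ?\<alpha> (tid X A) [\<theta>]) (tid X A) [\<phi>, cid X p] = ?\<alpha>"
      using ccomp_assoc_unary[of ?\<alpha> \<theta> "tid X A" "tid X A" "[\<phi>, cid X p]" "tid X B"] t(6)
        ccomp_cid_right[of ?\<alpha> p A] by simp
    then show "ccomp X (ccomp X ?\<alpha> (tid X A) [\<theta>]) (tid X (tdom X (cleft X (ccomp X ?\<alpha> (tid X A) [\<theta>]))))
        (map (cid X) [] @ [\<phi>] @ map (cid X) [p]) =
      ccomp X \<sigma> (tid X (tdom X (cleft X (ccomp X ?\<alpha> (tid X A) [\<theta>]))))
        (map (cid X) [] @ [\<phi>] @ map (cid X) [p])"
      by simp
  qed simp_all
  \<comment> \<open>\<open>?\<alpha>\<close> after \<open>\<psi>\<close> thus agrees with the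
    identity of \<open>q\<close> on \<open>\<sigma>\<close>, which can be cancelled as well.\<close>
  then have e: "ccomp X (ccomp X ?\<alpha> (tid X A) [\<psi>]) (tid X A) [\<sigma>] = ccomp X (cid X q) (tid X A) [\<sigma>]"
    using ccomp_assoc_unary[of ?\<alpha> \<psi> "tid X A" "tid X A" "[\<sigma>]" "tid X B"] psi(6)
      ccomp_cid_left[of \<sigma> q] by simp
  have 2: "ccomp X ?\<alpha> (tid X A) [\<psi>] = cid X q"
    by (rule left_opcartesian_cancel[OF lop, of _ _ A]) (use e in simp_all)
  have "gcell X ?\<alpha> [p] q" "gcell X \<psi> [q] p"
    by (simp_all add: gcell_def)
  with 1 2 have "iso_gcell X ?\<alpha> p q"
    unfolding iso_gcell_def gcomp_def by (intro conjI exI[of _ \<psi>]) simp_all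
  then show ?thesis
    by (simp add: gcomp_def)
qed

text \<open>Composition in the first slot is functorial, so \<open>\<phi> \<phi>' = 1\<close>
  persists when identities on \<open>rs\<close> are adjoined. Used in both orders, it makes
  precomposition with an isomorphism a bijection.\<close>

lemma whisker_inverse:
  assumes "\<psi> \<in> Cell X" and "cdom X \<psi> = p # rs" and "tdom X (cleft X \<psi>) = A"
    and \<phi>: "gcell X \<phi> [q] p" and \<phi>': "gcell X \<phi>' [p] q" and inv: "gcomp X \<phi> [\<phi>'] = cid X p"
  shows "ccomp X (ccomp X \<psi> (tid X A) (\<phi> # map (cid X) rs)) (tid X A) (\<phi>' # map (cid X) rs) = \<psi>"
proof -
  let ?B = "lsrc X p" and ?D = "tdom X (cright X \<psi>)"
  have ch: "p \<in> Loose X" "ltgt X p = A" "chain X ?B rs ?D" "A \<in> Obj X" "?B \<in> Obj X"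
    using cell_dom[OF assms(1)] assms(1,2,3) by auto
  have f: "\<phi> \<in> Cell X" "cdom X \<phi> = [q]" "ccod X \<phi> = p" "cleft X \<phi> = tid X A" "cright X \<phi> = tid X ?B"
    using \<phi> ch by (auto simp: gcell_def)
  have q: "ltgt X q = A" "lsrc X q = ?B"
    using cell_dom[OF f(1)] f ch by auto
  have f': "\<phi>' \<in> Cell X" "cdom X \<phi>' = [p]" "ccod X \<phi>' = q" "cleft X \<phi>' = tid X A" "cright X \<phi>' = tid X ?B"
    using \<phi>' q by (auto simp: gcell_def)
  have "ccomp X (ccomp X \<psi> (tid X A) ([\<phi>] @ map (cid X) rs)) (tid X A) (concat [[\<phi>']] @ map (cid X) rs) =
      ccomp X \<psi> (tcomp X (tid X A) (tid X A)) (ccomps X (tid X A) [\<phi>] [[\<phi>']] @ map (cid X) rs)"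
    by (rule ccomp_assoc_tail[where g="tid X ?B" and g'="tid X ?D" and k="tid X ?B" and k'="tid X ?D"])
      (use assms(1-3) ch f f' juxt_cids[OF ch(3)] chain_Loose[OF ch(3)] in simp_all)
  then show ?thesis
    using ccomp_cids_right[OF assms(1-3)] inv ch f by (simp add: gcomp_def)
qed

text \<open>A factorisation through \<open>\<sigma>\<close> becomes, once \<open>\<phi>\<close> is
  inserted, a factorisation through the isomorphism \<open>\<alpha>\<close>, which determines
  it.\<close>

lemma iso_imp_left_opcartesian:
  assumes op: "opcartesian X \<phi>" and \<phi>: "gcell X \<phi> [] u" and \<sigma>: "gcell X \<sigma> [u, p] q"
    and iso: "iso_gcell X (gcomp X \<sigma> [\<phi>, cid X p]) p q"
  shows "left_opcartesian X \<sigma>"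
  unfolding left_opcartesian_def
proof (intro conjI allI impI)
  define A where "A = ltgt X q"
  define B where "B = lsrc X q"
  have s: "\<sigma> \<in> Cell X" "cdom X \<sigma> = [u, p]" "ccod X \<sigma> = q" "cleft X \<sigma> = tid X A" "cright X \<sigma> = tid X B"
    using \<sigma> by (auto simp: gcell_def A_def B_def)
  then show "gcell X \<sigma> (cdom X \<sigma>) (ccod X \<sigma>)"
    using \<sigma> by simp
  have q: "q \<in> Loose X" "A \<in> Obj X" "B \<in> Obj X" "ltgt X q = A" "lsrc X q = B"
    using s cell_simps(3)[of \<sigma>] by (auto simp: A_def B_def)
  have up: "u \<in> Loose X" "ltgt X u = A" "p \<in> Loose X" "ltgt X p = lsrc X u" "lsrc X p = B"
    using cell_dom[OF s(1)] s q by auto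
  have f: "\<phi> \<in> Cell X" "cdom X \<phi> = []" "ccod X \<phi> = u" "cleft X \<phi> = tid X A" "cright X \<phi> = tid X (lsrc X u)"
    using \<phi> up by (auto simp: gcell_def)
  have u: "lsrc X u = A"
    using cell_dom[OF f(1)] f up q by simp
  note [simp] = s q up f u
  define \<alpha> where "\<alpha> = ccomp X \<sigma> (tid X A) [\<phi>, cid X p]"
  have al: "\<alpha> \<in> Cell X" "cdom X \<alpha> = [p]" "ccod X \<alpha> = q" "cleft X \<alpha> = tid X A" "cright X \<alpha> = tid X B"
    by (simp_all add: \<alpha>_def)
  note [simp] = al
  obtain \<beta> where be: "\<beta> \<in> Cell X" "cdom X \<beta> = [q]" "ccod X \<beta> = p" "cleft X \<beta> = tid X A" "cright X \<beta> = tid X B"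
      and be_al: "gcomp X \<beta> [\<alpha>] = cid X p" and al_be: "gcomp X \<alpha> [\<beta>] = cid X q"
    using iso by (auto simp: iso_gcell_def gcell_def gcomp_def \<alpha>_def)
  note [simp] = be
  have al': "gcell X \<alpha> [p] q" and be': "gcell X \<beta> [q] p"
    by (simp_all add: gcell_def)
  fix \<theta> rs
  assume "\<theta> \<in> Cell X \<and> cdom X \<theta> = cdom X \<sigma> @ rs \<and> cleft X \<theta> = cleft X \<sigma>"
  then have t [simp]: "\<theta> \<in> Cell X" "cdom X \<theta> = u # p # rs" "cleft X \<theta> = tid X A"
    by auto
  define D where "D = tdom X (cright X \<theta>)"
  have D [simp]: "D \<in> Obj X" "tdom X (cright X \<theta>) = D"
    by (simp_all add: D_def)
  have rs: "chain X B rs D"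
    using cell_dom[of \<theta>] by simp
  have jx [simp]: "juxt X (tid X B) (map (cid X) rs) (tid X D)"
    by (rule juxt_cids[OF rs])
  have [simp]: "set rs \<subseteq> Loose X"
    by (rule chain_Loose[OF rs])
  have whisk: "ccomp X (ccomp X \<psi> (tid X A) (\<sigma> # map (cid X) rs)) (tid X A) (\<phi> # cid X p # map (cid X) rs) =
      ccomp X \<psi> (tid X A) (\<alpha> # map (cid X) rs)"
    if "\<psi> \<in> Cell X" "cdom X \<psi> = q # rs" "cleft X \<psi> = tid X A" for \<psi>
    using ccomp_assoc_tail[of \<psi> "tid X A" "[\<sigma>]" "tid X B" rs "tid X D" "tid X A" "[[\<phi>, cid X p]]"
        "tid X B" "map (cid X) rs" "tid X D"] that
    by (simp add: \<alpha>_def)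
  let ?\<theta>\<phi> = "ccomp X \<theta> (tid X A) (\<phi> # cid X p # map (cid X) rs)"
  have tf: "?\<theta>\<phi> \<in> Cell X" "cdom X ?\<theta>\<phi> = p # rs" "ccod X ?\<theta>\<phi> = ccod X \<theta>" "cleft X ?\<theta>\<phi> = tid X A"
      "cright X ?\<theta>\<phi> = cright X \<theta>"
    using ccomp_simps[of \<theta> "tid X A" "\<phi> # cid X p # map (cid X) rs" "tid X D"] by simp_all
  \<comment> \<open>The only candidate: evaluate \<open>\<theta>\<close> at the unit, then undo
    \<open>\<alpha>\<close> by its inverse \<open>\<beta>\<close>.\<close>
  let ?\<psi> = "ccomp X ?\<theta>\<phi> (tid X A) (\<beta> # map (cid X) rs)"
  have ps: "?\<psi> \<in> Cell X" "cdom X ?\<psi> = q # rs" "ccod X ?\<psi> = ccod X \<theta>" "cleft X ?\<psi> = tid X A"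
      "cright X ?\<psi> = cright X \<theta>"
    using ccomp_simps[of ?\<theta>\<phi> "tid X A" "\<beta> # map (cid X) rs" "tid X D"] tf by simp_all
  show "\<exists>!\<psi>. opcart_factor X \<sigma> [] rs \<theta> \<psi>"
  proof
    let ?L = "ccomp X ?\<psi> (tid X A) (\<sigma> # map (cid X) rs)"
    have L: "?L \<in> Cell X" "cdom X ?L = u # p # rs" "ccod X ?L = ccod X \<theta>" "cleft X ?L = tid X A"
      "cright X ?L = cright X \<theta>"
      using ccomp_simps[of ?\<psi> "tid X A" "\<sigma> # map (cid X) rs" "tid X D"] ps by simp_all
    \<comment> \<open>Tested after inserting \<open>\<phi>\<close>: by \<open>whisk\<close> the
      left-hand side becomes \<open>?\<psi>\<close> composed with \<open>\<alpha>\<close>, where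
      \<open>\<beta>\<close> cancels against \<open>\<alpha>\<close>.\<close>
    have "?L = \<theta>"
    proof (rule opcartesian_cancel[OF op, of _ _ "[]" "p # rs"])
      have "ccomp X ?\<psi> (tid X A) (\<alpha> # map (cid X) rs) = ?\<theta>\<phi>"
        by (rule whisker_inverse[OF _ _ _ be' al' be_al]) (use tf in simp_all)
      then show "ccomp X ?L (tid X (tdom X (cleft X ?L))) (map (cid X) [] @ [\<phi>] @ map (cid X) (p # rs)) =
          ccomp X \<theta> (tid X (tdom X (cleft X ?L))) (map (cid X) [] @ [\<phi>] @ map (cid X) (p # rs))"
        using whisk[of ?\<psi>] ps L by simp
    qed (use L in simp_all)
    then show "opcart_factor X \<sigma> [] rs \<theta> ?\<psi>"
      using ps by (simp add: opcart_factor_def gcomp_def)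
    fix \<psi>
    assume "opcart_factor X \<sigma> [] rs \<theta> \<psi>"
    then have p: "\<psi> \<in> Cell X" "cdom X \<psi> = q # rs" "cleft X \<psi> = tid X A" "cright X \<psi> = cright X \<theta>"
        "ccomp X \<psi> (tid X A) (\<sigma> # map (cid X) rs) = \<theta>"
      by (auto simp: opcart_factor_def gcomp_def)
    have "ccomp X \<psi> (tid X A) (\<alpha> # map (cid X) rs) = ?\<theta>\<phi>"
      using whisk[of \<psi>] p by simp
    then show "\<psi> = ?\<psi>"
      using whisker_inverse[OF p(1,2) _ al' be' al_be] p by simp
  qed
qed

section \<open>A triangle identity and the Yoneda correspondence\<close>

text \<open>In flat form this is the left unit law for \<open>hmul\<close>.\<close>

lemma smile_at_frown:
  assumes "j \<in> Tight X" and "r \<in> Tight X" and "tcod X r = tcod X j" and "tdom X j = A"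
    and "\<phi> \<in> Cell X" and "ccod X \<phi> = hom X j r" and "cleft X \<phi> = tid X A"
  shows "ccomp X (smile_at X j j r) (tid X A) [frown X j, \<phi>] = \<phi>"
proof (rule flat_cancel[of j r])
  let ?L = "ccomp X (smile_at X j j r) (tid X A) [frown X j, \<phi>]"
  have A: "A \<in> Obj X" using assms by auto
  have s: "smile_at X j j r \<in> Cell X" "cdom X (smile_at X j j r) = [hom X j j, hom X j r]"
      "ccod X (smile_at X j j r) = hom X j r" "cleft X (smile_at X j j r) = tid X A"
      "cright X (smile_at X j j r) = tid X (tdom X r)"
    using smile_at_simps(1)[of j j r "tcod X j"] assms by (auto simp: gcell_def)
  have c: "tcod X (cright X \<phi>) = tdom X r"
    using flat_simps(7)[of j r \<phi>] assms by simp
  show "?L \<in> Cell X" "ccod X ?L = hom X j r" "cdom X \<phi> = cdom X ?L" "cleft X \<phi> = cleft X ?L"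
      "cright X \<phi> = cright X ?L"
    using ccomp_simps[of "smile_at X j j r" "tid X A" "[frown X j, \<phi>]" "cright X \<phi>"] s assms A c
    by simp_all
  have "flat j r ?L = hmul (tcod X j) (hunit j) (flat j r \<phi>)"
    using flat_smile_at[of j j r "tcod X j" "frown X j" \<phi> "tid X A"] assms A by simp
  also have "\<dots> = flat j r \<phi>"
    by (rule hmul_hunit_left) (use assms in auto)
  finally show "flat j r ?L = flat j r \<phi>" .
qed (use assms in auto)

text \<open>Yoneda: \<open>u\<close> is the universal element of \<open>C(l,1)\<close>, and \<open>\<pi>\<close> is \<open>\<alpha>\<close> evaluated at it.\<close>

lemma ext_cell_eq:
  assumes T: "j \<in> Tight X" "l \<in> Tight X" "r \<in> Tight X"
    and dc: "tdom X j = A" "tcod X j = E" "tdom X l = A" "tcod X l = C" "tdom X r = C" "tcod X r = E"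
    and \<alpha>: "gcell X \<alpha> [hom X l (tid X C)] (hom X j r)"
    and u: "u \<in> Cell X" "cdom X u = []" "ccod X u = hom X l (tid X C)" "cleft X u = tid X A"
      "cright X u = l" "flat l (tid X C) u = hunit l"
    and \<pi>: "gcell X \<pi> [] (hom X j (tcomp X r l))"
      "flat j (tcomp X r l) \<pi> = ccomp X (flat j r \<alpha>) (tid X A) [u]"
  shows "ext_cell X l j r \<pi> = \<alpha>"
proof -
  let ?H = "hom X l (tid X C)" and ?\<kappa> = "hom_cell X l (tid X C)" and ?U = "cid X (lid X C)"
  let ?rl = "tcomp X r l" and ?\<eta> = "lid_cell X C"
  have O [simp]: "A \<in> Obj X" "C \<in> Obj X" "E \<in> Obj X"
    using T dc by auto
  note [simp] = T dc u(1-5)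
  have [simp]: "\<alpha> \<in> Cell X" "cdom X \<alpha> = [?H]" "ccod X \<alpha> = hom X j r" "cleft X \<alpha> = tid X A"
      "cright X \<alpha> = tid X C"
    using \<alpha> by (auto simp: gcell_def)
  have [simp]: "\<pi> \<in> Cell X" "cdom X \<pi> = []" "ccod X \<pi> = hom X j ?rl" "cleft X \<pi> = tid X A"
      "cright X \<pi> = tid X A"
    using \<pi>(1) by (auto simp: gcell_def)
  have S [simp]: "smile_at X ?rl j r \<in> Cell X" "cdom X (smile_at X ?rl j r) = [hom X j ?rl, hom X ?rl r]"
      "ccod X (smile_at X ?rl j r) = hom X j r" "cleft X (smile_at X ?rl j r) = tid X A"
      "cright X (smile_at X ?rl j r) = tid X C"
    using smile_at_simps(1)[of ?rl j r E] by (auto simp: gcell_def)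
  have F [simp]: "frown_at X r l \<in> Cell X" "cdom X (frown_at X r l) = [?H]"
      "ccod X (frown_at X r l) = hom X ?rl r" "cleft X (frown_at X r l) = tid X A"
      "cright X (frown_at X r l) = tid X C"
    using frown_at_simps(1)[of r l C] by (auto simp: gcell_def)
  define a where "a = flat j r \<alpha>"
  have a [simp]: "a \<in> Cell X" "cdom X a = [?H]" "ccod X a = lid X E" "cleft X a = j" "cright X a = r"
    by (simp_all add: a_def)
  \<comment> \<open>The nullary \<open>\<pi>\<close> receives an empty block and the identity beside
    it receives \<open>frown_at\<close>, so the two-stage extension cell is a single use of the
    counit.\<close>
  have "ccomp X (hom_act X \<pi> j ?rl r) (tid X A) [frown_at X r l] =
      ccomp X (smile_at X ?rl j r) (tid X A) [\<pi>, frown_at X r l]"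
  proof -
    have p1: "ccomp X \<pi> (tid X A) [] = \<pi>"
      using ccomp_cids_right[of \<pi> "[]" A] by simp
    have p2: "ccomp X (cid X (hom X ?rl r)) (tid X A) [frown_at X r l] = frown_at X r l"
      by (rule ccomp_cid_left) simp_all
    have "composable X (smile_at X ?rl j r) (tid X A) [\<pi>, cid X (hom X ?rl r)] (tid X C)"
      by (simp add: composable_def)
    from ccomp_assoc[OF this, of "tid X A" "[[], [frown_at X r l]]" "tid X C"] show ?thesis
      by (simp add: hom_act_def gcomp_def p1 p2)
  qed
  then have ext: "ext_cell X l j r \<pi> = ccomp X (smile_at X ?rl j r) (tid X A) [\<pi>, frown_at X r l]"
    by (simp add: ext_cell_def gcomp_def hom_act_def)
  \<comment> \<open>\<open>m\<close> is the right action of \<open>C(1,1)\<close> on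
    \<open>C(l,1)\<close>, specified by its flat form.\<close>
  obtain m where m [simp]: "m \<in> Cell X" "cdom X m = [?H, lid X C]" "ccod X m = ?H" "cleft X m = tid X A"
      "cright X m = tid X C" and fm: "flat l (tid X C) m = hmul C ?\<kappa> ?U"
    by (rule flat_lift[of l "tid X C" "hmul C ?\<kappa> ?U" "tid X A" "tid X C"]) simp_all
  have m_flat: "flat l (tid X C) (ccomp X m h [\<phi>, \<psi>]) = hmul C (flat l (tid X C) \<phi>) \<psi>"
    if "\<phi> \<in> Cell X" "ccod X \<phi> = ?H" "\<psi> \<in> Cell X" "ccod X \<psi> = lid X C" "cright X \<phi> = cleft X \<psi>"
      "cleft X \<phi> = h" for \<phi> \<psi> h
  proof -
    have h: "h \<in> Tight X" "tcod X h = A"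
      using that flat_simps(6)[of l "tid X C" \<phi>] by auto
    have c: "tcod X (cleft X \<psi>) = C"
      using that tcod_cell_lid[of \<psi> C] by simp
    have "flat l (tid X C) (ccomp X m h [\<phi>, \<psi>]) = ccomp X (hmul C ?\<kappa> ?U) h ([\<phi>] @ [\<psi>])"
      using flat_ccomp[of l "tid X C" m h "[\<phi>, \<psi>]" "cright X \<psi>"] that h fm by simp
    also have "\<dots> = hmul C (ccomp X ?\<kappa> h [\<phi>]) (ccomp X ?U (cleft X \<psi>) [\<psi>])"
      by (rule hmul_ccomp[where k'="cright X \<psi>"]) (use that h c in simp_all)
    finally show ?thesis
      using that ccomp_cid_left[of \<psi> "lid X C"] by (simp add: flat_def)
  qed
  \<comment> \<open>The core of Yoneda: the universal element, acted on by the generic element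
    \<open>?\<kappa>\<close>, gives the identity of \<open>C(l,1)\<close>.\<close>
  have m_u: "ccomp X m (tid X A) [u, ?\<kappa>] = cid X ?H"
  proof (rule flat_cancel[of l "tid X C"])
    show "flat l (tid X C) (ccomp X m (tid X A) [u, ?\<kappa>]) = flat l (tid X C) (cid X ?H)"
      using m_flat[of u ?\<kappa> "tid X A"] hmul_hunit_left[of C ?\<kappa> l] u(6) by (simp add: flat_cid)
  qed simp_all
  have \<eta>: "?\<eta> = hunit (tid X C)"
    using ccomp_cids_right[of ?\<eta> "[]" C] by (simp add: hunit_def)
  have m_\<eta>: "ccomp X m (tid X A) [cid X ?H, ?\<eta>] = cid X ?H"
  proof (rule flat_cancel[of l "tid X C"])
    show "flat l (tid X C) (ccomp X m (tid X A) [cid X ?H, ?\<eta>]) = flat l (tid X C) (cid X ?H)"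
      using m_flat[of "cid X ?H" ?\<eta> "tid X A"] hmul_hunit_right[of C ?\<kappa> "tid X C"] \<eta>
      by (simp add: flat_cid)
  qed simp_all
  have aH: "ccomp X a (tid X A) [cid X ?H] = a"
    by (rule ccomp_cid_right) simp_all
  \<comment> \<open>Naturality: \<open>a\<close> intertwines the action \<open>m\<close> with the
    action of \<open>r\<close> on loose-identities. On the unit of \<open>C(1,1)\<close> both sides
    reduce to \<open>a\<close>.\<close>
  have "hmul E a (hfun r) = ccomp X a (tid X A) [m]" (is "?L = ?R")
  proof (rule opcartesian_cancel[of ?\<eta> _ _ "[?H]" "[]"])
    have "ccomp X ?L (tid X A) ([cid X ?H] @ [?\<eta>]) =
        hmul E (ccomp X a (tid X A) [cid X ?H]) (ccomp X (hfun r) (tid X C) [?\<eta>])"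
      by (rule hmul_ccomp[where k'="tid X C"]) simp_all
    also have "\<dots> = a"
      using hfun_simps(6)[of r] aH hmul_hunit_right[of E a r] by simp
    finally have 1: "ccomp X ?L (tid X A) [cid X ?H, ?\<eta>] = a"
      by simp
    have 2: "ccomp X ?R (tid X A) [cid X ?H, ?\<eta>] = a"
      using ccomp_assoc_unary[of a m "tid X A" "tid X A" "[cid X ?H, ?\<eta>]" "tid X C"] m_\<eta> aH by simp
    show "ccomp X ?L (tid X (tdom X (cleft X ?L))) (map (cid X) [?H] @ [?\<eta>] @ map (cid X) []) =
        ccomp X ?R (tid X (tdom X (cleft X ?L))) (map (cid X) [?H] @ [?\<eta>] @ map (cid X) [])"
      using 1 2 by simp
  qed simp_all
  moreover have "ccomp X (hmul E a (hfun r)) (tid X A) ([u] @ [?\<kappa>]) =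
      hmul E (ccomp X a (tid X A) [u]) (ccomp X (hfun r) l [?\<kappa>])"
    by (rule hmul_ccomp[where k'="tid X C"]) simp_all
  \<comment> \<open>Naturality evaluated at \<open>u\<close> and \<open>?\<kappa>\<close>. The
    factors on the left are the flat forms of \<open>\<pi>\<close> and of
    \<open>frown_at\<close>.\<close>
  ultimately have "hmul E (ccomp X a (tid X A) [u]) (ccomp X (hfun r) l [?\<kappa>]) =
      ccomp X (ccomp X a (tid X A) [m]) (tid X A) [u, ?\<kappa>]"
    by simp
  also have "\<dots> = a"
    using ccomp_assoc_unary[of a m "tid X A" "tid X A" "[u, ?\<kappa>]" "tid X C"] m_u aH by simp
  finally have key: "hmul E (ccomp X a (tid X A) [u]) (ccomp X (hfun r) l [?\<kappa>]) = a" .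
  show ?thesis
  proof (rule flat_cancel[of j r])
    show "flat j r (ext_cell X l j r \<pi>) = flat j r \<alpha>"
      using flat_smile_at[of ?rl j r E \<pi> "frown_at X r l" "tid X A"] frown_at_simps(2)[of r l C] \<pi>(2) key
      by (simp add: ext a_def)
  qed (simp_all add: ext)
qed

text \<open>The empty domain sits at \<open>A\<close>, while the right end of \<open>C(l,1)\<close>
  is \<open>C\<close>; so the cell needs right tight-cell \<open>l\<close>. This matches the frame
  of \<open>hunit l\<close>, read as \<open>l 1\<close> on the left and \<open>1 l\<close> on the
  right.\<close>

lemma universal_element:
  assumes "l \<in> Tight X" and "tdom X l = A" and "tcod X l = C"
  obtains u where "u \<in> Cell X" "cdom X u = []" "ccod X u = hom X l (tid X C)" "cleft X u = tid X A"
    "cright X u = l" "flat l (tid X C) u = hunit l"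
proof (rule flat_lift[of l "tid X C" "hunit l" "tid X A" l])
qed (use assms tdom_Obj[of l] tcod_Obj[of l] that in auto)

text \<open>Evaluating \<open>\<alpha>\<close> at the universal element gives a nullary cell with
  tight-cells \<open>j\<close> and \<open>r l\<close>. Its lift through \<open>E(j, r l)\<close> is
  \<open>\<pi>\<close>, and \<open>ext_cell_eq\<close> recovers \<open>\<alpha>\<close>.\<close>

lemma ext_cell_surj:
  assumes T: "j \<in> Tight X" "l \<in> Tight X" "r \<in> Tight X"
    and dc: "tdom X j = A" "tcod X j = E" "tdom X l = A" "tcod X l = C" "tdom X r = C" "tcod X r = E"
    and \<alpha>: "gcell X \<alpha> [hom X l (tid X C)] (hom X j r)"
  obtains \<pi> where "tight_2cell X \<pi> j (tcomp X r l)" "ext_cell X l j r \<pi> = \<alpha>"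
proof -
  have O: "A \<in> Obj X" "C \<in> Obj X" "E \<in> Obj X"
    using T dc by auto
  obtain u where u: "u \<in> Cell X" "cdom X u = []" "ccod X u = hom X l (tid X C)" "cleft X u = tid X A"
    "cright X u = l" "flat l (tid X C) u = hunit l"
    using universal_element[OF T(2) dc(3,4)] by blast
  have a: "\<alpha> \<in> Cell X" "cdom X \<alpha> = [hom X l (tid X C)]" "ccod X \<alpha> = hom X j r" "cleft X \<alpha> = tid X A"
      "cright X \<alpha> = tid X C"
    using \<alpha> T dc by (auto simp: gcell_def)
  let ?P = "ccomp X (flat j r \<alpha>) (tid X A) [u]"
  have P: "?P \<in> Cell X" "cdom X ?P = []" "ccod X ?P = lid X E" "cleft X ?P = j" "cright X ?P = tcomp X r l"
    using T dc O a u(1-5) by simp_all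
  obtain \<pi> where \<pi>: "\<pi> \<in> Cell X" "cdom X \<pi> = []" "ccod X \<pi> = hom X j (tcomp X r l)"
      "cleft X \<pi> = tid X A" "cright X \<pi> = tid X A" "flat j (tcomp X r l) \<pi> = ?P"
    by (rule flat_lift[of j "tcomp X r l" ?P "tid X A" "tid X A"]) (use T dc O P in simp_all)
  have g: "gcell X \<pi> [] (hom X j (tcomp X r l))"
    using \<pi> T dc by (simp add: gcell_def)
  show thesis
  proof (rule that)
    show "tight_2cell X \<pi> j (tcomp X r l)"
      using g T dc by (simp add: tight_2cell_def)
    show "ext_cell X l j r \<pi> = \<alpha>"
      by (rule ext_cell_eq[OF T dc \<alpha> u g \<pi>(6)])
  qed
qed

section \<open>Colimits in flat form\<close>

text \<open>The flat counterpart of a \<open>gcell\<close> into \<open>hom X f g\<close>: since the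
  codomain is now always \<open>E(1,1)\<close>, the frame has to record \<open>f\<close> and
  \<open>g\<close>.\<close>

definition lcell :: "'o \<Rightarrow> 't \<Rightarrow> 'l list \<Rightarrow> 't \<Rightarrow> 'c \<Rightarrow> bool" where
  "lcell E f ps g \<theta> \<longleftrightarrow> \<theta> \<in> Cell X \<and> cdom X \<theta> = ps \<and> ccod X \<theta> = lid X E \<and>
     cleft X \<theta> = f \<and> cright X \<theta> = g"

lemma flat_bij:
  assumes "f \<in> Tight X" and "g \<in> Tight X" and "tcod X f = E" and "tcod X g = E"
  shows "bij_betw (flat f g) {\<psi>. gcell X \<psi> ps (hom X f g)} {\<theta>. lcell E f ps g \<theta>}"
proof (rule bij_betw_imageI)
  show "inj_on (flat f g) {\<psi>. gcell X \<psi> ps (hom X f g)}"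
  proof (rule inj_onI)
    fix \<psi> \<psi>'
    assume *: "\<psi> \<in> {\<psi>. gcell X \<psi> ps (hom X f g)}" "\<psi>' \<in> {\<psi>. gcell X \<psi> ps (hom X f g)}"
      "flat f g \<psi> = flat f g \<psi>'"
    show "\<psi> = \<psi>'"
      by (rule flat_cancel[of f g]) (use assms * in \<open>auto simp: gcell_def\<close>)
  qed
  show "flat f g ` {\<psi>. gcell X \<psi> ps (hom X f g)} = {\<theta>. lcell E f ps g \<theta>}"
  proof (intro equalityI subsetI)
    fix \<theta> assume "\<theta> \<in> flat f g ` {\<psi>. gcell X \<psi> ps (hom X f g)}"
    then show "\<theta> \<in> {\<theta>. lcell E f ps g \<theta>}"
      using assms by (auto simp: gcell_def lcell_def)
  next
    fix \<theta> assume "\<theta> \<in> {\<theta>. lcell E f ps g \<theta>}"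
    then have t: "\<theta> \<in> Cell X" "cdom X \<theta> = ps" "ccod X \<theta> = lid X E" "cleft X \<theta> = f" "cright X \<theta> = g"
      by (auto simp: lcell_def)
    obtain \<psi> where p: "\<psi> \<in> Cell X" "cdom X \<psi> = cdom X \<theta>" "ccod X \<psi> = hom X f g"
        "cleft X \<psi> = tid X (tdom X f)" "cright X \<psi> = tid X (tdom X g)" "flat f g \<psi> = \<theta>"
      by (rule flat_lift[of f g \<theta> "tid X (tdom X f)" "tid X (tdom X g)"]) (use assms t in auto)
    then have "gcell X \<psi> ps (hom X f g)"
      using assms t by (simp add: gcell_def)
    with p(6) show "\<theta> \<in> flat f g ` {\<psi>. gcell X \<psi> ps (hom X f g)}"
      by blast
  qed
qed

text \<open>Source and target of the right lift are both homs of \<open>W\<close>, so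
  \<open>flat\<close> carries each side of the universal property bijectively to cells into
  \<open>W(1,1)\<close>, and the counit becomes \<open>hmul\<close>. In this form density can be
  manipulated without comparison cells.\<close>

lemma is_colimit_iff:
  assumes "f \<in> Tight X" and "c \<in> Tight X" and "tcod X f = W" and "tcod X c = W"
    and "p \<in> Loose X" and "lsrc X p = tdom X c" and "ltgt X p = tdom X f"
    and lam: "gcell X lam [p] (hom X f c)"
  shows "is_colimit X p f c lam \<longleftrightarrow>
    (\<forall>rs \<theta>. lcell W f (p # rs) (tid X W) \<theta> \<longrightarrow>
      (\<exists>!\<psi>. lcell W c rs (tid X W) \<psi> \<and> hmul W (flat f c lam) \<psi> = \<theta>))"
proof -
  let ?q = "hom X f (tid X W)" and ?s = "hom X c (tid X W)"
  let ?S = "smile_at X c f (tid X W)"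
  let ?\<omega> = "gcomp X ?S [lam, cid X ?s]"
  have W [simp]: "W \<in> Obj X" using assms by auto
  note [simp] = assms(1-7)
  have l [simp]: "lam \<in> Cell X" "cdom X lam = [p]" "ccod X lam = hom X f c"
      "cleft X lam = tid X (tdom X f)" "cright X lam = tid X (tdom X c)"
    using lam by (auto simp: gcell_def)
  have S [simp]: "?S \<in> Cell X" "cdom X ?S = [hom X f c, ?s]" "ccod X ?S = ?q"
      "cleft X ?S = tid X (tdom X f)" "cright X ?S = tid X W"
    using smile_at_simps(1)[of c f "tid X W" W] by (auto simp: gcell_def)
  have om: "gcell X ?\<omega> [p, ?s] ?q"
    by (simp add: gcell_def gcomp_def)
  have comp: "flat f (tid X W) (gcomp X ?\<omega> [cid X p, \<psi>]) = hmul W (flat f c lam) (flat c (tid X W) \<psi>)"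
    and compg: "gcell X (gcomp X ?\<omega> [cid X p, \<psi>]) (p # rs) ?q"
    if "gcell X \<psi> rs ?s" for \<psi> rs
  proof -
    have p [simp]: "\<psi> \<in> Cell X" "cdom X \<psi> = rs" "ccod X \<psi> = ?s" "cleft X \<psi> = tid X (tdom X c)"
        "cright X \<psi> = tid X W"
      using that by (auto simp: gcell_def)
    have c1: "ccomp X lam (tid X (tdom X f)) [cid X p] = lam"
      by (rule ccomp_cid_right) simp_all
    have c2: "ccomp X (cid X ?s) (tid X (tdom X c)) [\<psi>] = \<psi>"
      by (rule ccomp_cid_left) simp_all
    have "composable X ?S (tid X (tdom X f)) [lam, cid X ?s] (tid X W)"
      by (simp add: composable_def)
    from ccomp_assoc[OF this, of "tid X (tdom X f)" "[[cid X p], [\<psi>]]" "tid X W"]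
    have eq: "gcomp X ?\<omega> [cid X p, \<psi>] = ccomp X ?S (tid X (tdom X f)) [lam, \<psi>]"
      by (simp add: gcomp_def c1 c2)
    then show "gcell X (gcomp X ?\<omega> [cid X p, \<psi>]) (p # rs) ?q"
      by (simp add: gcell_def)
    show "flat f (tid X W) (gcomp X ?\<omega> [cid X p, \<psi>]) = hmul W (flat f c lam) (flat c (tid X W) \<psi>)"
      unfolding eq by (rule flat_smile_at) simp_all
  qed
  have bs: "bij_betw (flat c (tid X W)) {\<psi>. gcell X \<psi> rs ?s} {\<psi>. lcell W c rs (tid X W) \<psi>}" for rs
    by (rule flat_bij) simp_all
  have bq: "bij_betw (flat f (tid X W)) {\<theta>. gcell X \<theta> rs ?q} {\<theta>. lcell W f rs (tid X W) \<theta>}" for rs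
    by (rule flat_bij) simp_all
  have ex1: "(\<exists>!\<psi>. gcell X \<psi> rs ?s \<and> gcomp X ?\<omega> [cid X p, \<psi>] = \<theta>) \<longleftrightarrow>
      (\<exists>!\<psi>. lcell W c rs (tid X W) \<psi> \<and> hmul W (flat f c lam) \<psi> = flat f (tid X W) \<theta>)"
    if "gcell X \<theta> (p # rs) ?q" for rs \<theta>
  proof -
    \<comment> \<open>Injectivity of \<open>flat\<close> on cells with the same globular frame
      reflects the equation.\<close>
    have eqv: "gcomp X ?\<omega> [cid X p, \<psi>] = \<theta> \<longleftrightarrow>
        hmul W (flat f c lam) (flat c (tid X W) \<psi>) = flat f (tid X W) \<theta>" if "gcell X \<psi> rs ?s" for \<psi>
      using comp[OF that] compg[OF that] \<open>gcell X \<theta> (p # rs) ?q\<close> bq[of "p # rs"]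
      by (metis (mono_tags, lifting) bij_betw_imp_inj_on inj_onD mem_Collect_eq)
    show ?thesis
    proof
      assume "\<exists>!\<psi>. gcell X \<psi> rs ?s \<and> gcomp X ?\<omega> [cid X p, \<psi>] = \<theta>"
      then obtain \<psi> where p: "gcell X \<psi> rs ?s" "gcomp X ?\<omega> [cid X p, \<psi>] = \<theta>"
        and un: "\<And>\<psi>'. gcell X \<psi>' rs ?s \<Longrightarrow> gcomp X ?\<omega> [cid X p, \<psi>'] = \<theta> \<Longrightarrow> \<psi>' = \<psi>"
        by blast
      show "\<exists>!\<psi>. lcell W c rs (tid X W) \<psi> \<and> hmul W (flat f c lam) \<psi> = flat f (tid X W) \<theta>"
      proof (rule ex1I[of _ "flat c (tid X W) \<psi>"])
        show "lcell W c rs (tid X W) (flat c (tid X W) \<psi>) \<and>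
            hmul W (flat f c lam) (flat c (tid X W) \<psi>) = flat f (tid X W) \<theta>"
          using p eqv bij_betwE[OF bs[of rs]] by blast
        fix \<Psi> assume P: "lcell W c rs (tid X W) \<Psi> \<and> hmul W (flat f c lam) \<Psi> = flat f (tid X W) \<theta>"
        then obtain \<psi>' where p': "gcell X \<psi>' rs ?s" "\<Psi> = flat c (tid X W) \<psi>'"
          using bij_betw_imp_surj_on[OF bs[of rs]] by blast
        then show "\<Psi> = flat c (tid X W) \<psi>"
          using un[OF p'(1)] eqv[OF p'(1)] P by simp
      qed
    next
      assume "\<exists>!\<psi>. lcell W c rs (tid X W) \<psi> \<and> hmul W (flat f c lam) \<psi> = flat f (tid X W) \<theta>"
      then obtain \<Psi> where p: "lcell W c rs (tid X W) \<Psi>" "hmul W (flat f c lam) \<Psi> = flat f (tid X W) \<theta>"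
        and un: "\<And>\<psi>'. lcell W c rs (tid X W) \<psi>' \<Longrightarrow> hmul W (flat f c lam) \<psi>' = flat f (tid X W) \<theta> \<Longrightarrow> \<psi>' = \<Psi>"
        by blast
      obtain \<psi> where p': "gcell X \<psi> rs ?s" "\<Psi> = flat c (tid X W) \<psi>"
        using p(1) bij_betw_imp_surj_on[OF bs[of rs]] by blast
      show "\<exists>!\<psi>. gcell X \<psi> rs ?s \<and> gcomp X ?\<omega> [cid X p, \<psi>] = \<theta>"
      proof (rule ex1I[of _ \<psi>])
        show "gcell X \<psi> rs ?s \<and> gcomp X ?\<omega> [cid X p, \<psi>] = \<theta>"
          using p p' eqv by blast
        fix \<psi>' assume P: "gcell X \<psi>' rs ?s \<and> gcomp X ?\<omega> [cid X p, \<psi>'] = \<theta>"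
        then have "flat c (tid X W) \<psi>' = flat c (tid X W) \<psi>"
          using un eqv bij_betwE[OF bs[of rs]] p'(2) by blast
        then show "\<psi>' = \<psi>"
          using P p'(1) bij_betw_imp_inj_on[OF bs[of rs]] by (auto dest: inj_onD)
      qed
    qed
  qed
  have "is_colimit X p f c lam \<longleftrightarrow> right_lift X p ?q ?s ?\<omega>"
    using lam by (auto simp: is_colimit_def loose_cell_def tight_cell_def)
  also have "\<dots> \<longleftrightarrow> (\<forall>rs \<theta>. gcell X \<theta> (p # rs) ?q \<longrightarrow>
      (\<exists>!\<psi>. gcell X \<psi> rs ?s \<and> gcomp X ?\<omega> [cid X p, \<psi>] = \<theta>))"
    using om by (simp add: right_lift_def loose_cell_def)
  also have "\<dots> \<longleftrightarrow> (\<forall>rs \<theta>. gcell X \<theta> (p # rs) ?q \<longrightarrow>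
      (\<exists>!\<psi>. lcell W c rs (tid X W) \<psi> \<and> hmul W (flat f c lam) \<psi> = flat f (tid X W) \<theta>))"
    by (intro all_cong1 imp_cong refl ex1)
  also have "\<dots> \<longleftrightarrow> (\<forall>rs \<theta>. lcell W f (p # rs) (tid X W) \<theta> \<longrightarrow>
      (\<exists>!\<psi>. lcell W c rs (tid X W) \<psi> \<and> hmul W (flat f c lam) \<psi> = \<theta>))"
  proof -
    have rw: "(\<forall>\<theta>. gcell X \<theta> (p # rs) ?q \<longrightarrow> P (flat f (tid X W) \<theta>)) \<longleftrightarrow>
        (\<forall>\<theta>. lcell W f (p # rs) (tid X W) \<theta> \<longrightarrow> P \<theta>)" for P rs
    proof -
      have "(\<forall>\<theta>\<in>flat f (tid X W) ` {\<theta>. gcell X \<theta> (p # rs) ?q}. P \<theta>) \<longleftrightarrow>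
          (\<forall>\<theta>\<in>{\<theta>. lcell W f (p # rs) (tid X W) \<theta>}. P \<theta>)"
        by (simp only: bij_betw_imp_surj_on[OF bq])
      then show ?thesis by simp
    qed
    show ?thesis by (rule all_cong1) (rule rw)
  qed
  finally show ?thesis .
qed

section \<open>Density and its transport\<close>

text \<open>Density is applied with the tail enlarged by \<open>E(1,r)\<close>: expand
  \<open>\<theta>\<close> along \<open>m\<close>, factor, then contract by inserting
  \<open>v\<close>.\<close>

lemma density_restrict:
  assumes T: "j \<in> Tight X" "r \<in> Tight X" and dc: "tdom X j = A" "tcod X j = E" "tdom X r = C" "tcod X r = E"
    and dense: "\<And>rs \<theta>. lcell E j (hom X j (tid X E) # rs) (tid X E) \<theta> \<Longrightarrow>
      \<exists>!\<psi>. lcell E (tid X E) rs (tid X E) \<psi> \<and> hmul E (hom_cell X j (tid X E)) \<psi> = \<theta>"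
    and \<theta>: "lcell E j (hom X j r # rs) (tid X E) \<theta>"
  shows "\<exists>!\<psi>. lcell E r rs (tid X E) \<psi> \<and> hmul E (hom_cell X j r) \<psi> = \<theta>"
proof -
  let ?\<kappa>j = "hom_cell X j (tid X E)" and ?\<kappa>r = "hom_cell X (tid X E) r" and ?\<kappa> = "hom_cell X j r"
  let ?rs = "map (cid X) rs"
  have O [simp]: "A \<in> Obj X" "C \<in> Obj X" "E \<in> Obj X"
    using T dc by auto
  note [simp] = T dc
  have t [simp]: "\<theta> \<in> Cell X" "cdom X \<theta> = hom X j r # rs" "ccod X \<theta> = lid X E" "cleft X \<theta> = j"
      "cright X \<theta> = tid X E"
    using \<theta> by (auto simp: lcell_def)
  have ch: "chain X C rs E"
    using cell_dom[of \<theta>] by simp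
  have rs [simp]: "juxt X (tid X C) ?rs (tid X E)" "set rs \<subseteq> Loose X"
    using juxt_cids[OF ch] chain_Loose[OF ch] by auto
  \<comment> \<open>\<open>v\<close> is the unit of \<open>r\<close> with left tight-cell
    \<open>r\<close>, and \<open>n\<close> below is the comparison from \<open>E(j,r)\<close> to
    \<open>E(j,1)\<close> with right tight-cell \<open>r\<close>; hence they are adjacent.\<close>
  obtain v where v [simp]: "v \<in> Cell X" "cdom X v = []" "ccod X v = hom X (tid X E) r" "cleft X v = r"
      "cright X v = tid X C" and fv: "flat (tid X E) r v = hunit r"
    by (rule flat_lift[of "tid X E" r "hunit r" r "tid X C"]) simp_all
  obtain n where n [simp]: "n \<in> Cell X" "cdom X n = [hom X j r]" "ccod X n = hom X j (tid X E)"
      "cleft X n = tid X A" "cright X n = r" and fn: "flat j (tid X E) n = ?\<kappa>"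
    by (rule flat_lift[of j "tid X E" ?\<kappa> "tid X A" r]) simp_all
  obtain m where m [simp]: "m \<in> Cell X" "cdom X m = [hom X j (tid X E), hom X (tid X E) r]"
      "ccod X m = hom X j r" "cleft X m = tid X A" "cright X m = tid X C"
      and fm: "flat j r m = hmul E ?\<kappa>j ?\<kappa>r"
    by (rule flat_lift[of j r "hmul E ?\<kappa>j ?\<kappa>r" "tid X A" "tid X C"]) simp_all
  \<comment> \<open>In flat form this is the right unit law: \<open>(n, v)\<close> splits
    \<open>m\<close>.\<close>
  have mnv: "ccomp X m (tid X A) [n, v] = cid X (hom X j r)"
  proof (rule flat_cancel[of j r])
    have "flat j r (ccomp X m (tid X A) [n, v]) = ccomp X (hmul E ?\<kappa>j ?\<kappa>r) (tid X A) ([n] @ [v])"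
      using flat_ccomp[of j r m "tid X A" "[n, v]" "tid X C"] fm by simp
    also have "\<dots> = hmul E (ccomp X ?\<kappa>j (tid X A) [n]) (ccomp X ?\<kappa>r r [v])"
      by (rule hmul_ccomp[where k'="tid X C"]) simp_all
    also have "\<dots> = hmul E ?\<kappa> (hunit r)"
      using fn fv by (simp add: flat_def)
    also have "\<dots> = ?\<kappa>"
      by (rule hmul_hunit_right) simp_all
    finally show "flat j r (ccomp X m (tid X A) [n, v]) = flat j r (cid X (hom X j r))"
      by (simp add: flat_cid)
  qed simp_all
  define \<theta>m where "\<theta>m = ccomp X \<theta> (tid X A) (m # ?rs)"
  have "lcell E j (hom X j (tid X E) # hom X (tid X E) r # rs) (tid X E) \<theta>m"
    using ccomp_simps[of \<theta> "tid X A" "m # ?rs" "tid X E"] by (simp add: lcell_def \<theta>m_def)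
  from dense[OF this] obtain \<psi>0 where
    p0: "lcell E (tid X E) (hom X (tid X E) r # rs) (tid X E) \<psi>0" "hmul E ?\<kappa>j \<psi>0 = \<theta>m"
    and un: "\<And>\<psi>. lcell E (tid X E) (hom X (tid X E) r # rs) (tid X E) \<psi> \<Longrightarrow> hmul E ?\<kappa>j \<psi> = \<theta>m \<Longrightarrow> \<psi> = \<psi>0"
    by blast
  have p0' [simp]: "\<psi>0 \<in> Cell X" "cdom X \<psi>0 = hom X (tid X E) r # rs" "ccod X \<psi>0 = lid X E"
      "cleft X \<psi>0 = tid X E" "cright X \<psi>0 = tid X E"
    using p0(1) by (auto simp: lcell_def)
  \<comment> \<open>Inserting \<open>v\<close> deletes \<open>E(1,r)\<close> from the domain and
    changes the left tight-cell from the identity to \<open>r\<close>.\<close>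
  define \<psi>1 where "\<psi>1 = ccomp X \<psi>0 r (v # ?rs)"
  show ?thesis
  proof (rule ex1I[of _ \<psi>1], intro conjI)
    show "lcell E r rs (tid X E) \<psi>1"
      using ccomp_simps[of \<psi>0 r "v # ?rs" "tid X E"] by (simp add: lcell_def \<psi>1_def)
    have "hmul E (ccomp X ?\<kappa>j (tid X A) [n]) \<psi>1 = ccomp X (hmul E ?\<kappa>j \<psi>0) (tid X A) ([n] @ (v # ?rs))"
      unfolding \<psi>1_def by (rule hmul_ccomp[where k'="tid X E", symmetric]) simp_all
    also have "\<dots> = ccomp X \<theta> (tid X A) (ccomp X m (tid X A) [n, v] # ?rs)"
      using ccomp_assoc_tail[of \<theta> "tid X A" "[m]" "tid X C" rs "tid X E" "tid X A" "[[n, v]]"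
        "tid X C" ?rs "tid X E"] p0(2) by (simp add: \<theta>m_def)
    also have "\<dots> = \<theta>"
      using ccomp_cids_right[of \<theta> "hom X j r # rs" A] by (simp add: mnv)
    finally show "hmul E ?\<kappa> \<psi>1 = \<theta>"
      using fn by (simp add: flat_def)
  next
    fix \<psi>
    assume a: "lcell E r rs (tid X E) \<psi> \<and> hmul E ?\<kappa> \<psi> = \<theta>"
    then have p [simp]: "\<psi> \<in> Cell X" "cdom X \<psi> = rs" "ccod X \<psi> = lid X E" "cleft X \<psi> = r"
        "cright X \<psi> = tid X E"
      by (auto simp: lcell_def)
    have e: "ccomp X \<psi> (tid X C) ?rs = \<psi>"
      by (rule ccomp_cids_right) simp_all
    \<comment> \<open>Multiplying a competing solution by \<open>?\<kappa>r\<close> solves the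
      density problem, so it gives \<open>\<psi>0\<close>. Inserting \<open>v\<close> then recovers
      the competitor by the left unit law.\<close>
    have "hmul E ?\<kappa>j (hmul E ?\<kappa>r \<psi>) = hmul E (hmul E ?\<kappa>j ?\<kappa>r) \<psi>"
      by (rule hmul_assoc[symmetric]) simp_all
    also have "\<dots> = hmul E (ccomp X ?\<kappa> (tid X A) [m]) (ccomp X \<psi> (tid X C) ?rs)"
      using fm e by (simp add: flat_def)
    also have "\<dots> = ccomp X (hmul E ?\<kappa> \<psi>) (tid X A) ([m] @ ?rs)"
      by (rule hmul_ccomp[where k'="tid X E", symmetric]) simp_all
    also have "\<dots> = \<theta>m"
      using a by (simp add: \<theta>m_def)
    finally have "hmul E ?\<kappa>r \<psi> = \<psi>0"
      by (intro un) (simp_all add: lcell_def)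
    then have "\<psi>1 = ccomp X (hmul E ?\<kappa>r \<psi>) r ([v] @ ?rs)"
      by (simp add: \<psi>1_def)
    also have "\<dots> = hmul E (ccomp X ?\<kappa>r r [v]) (ccomp X \<psi> (tid X C) ?rs)"
      by (rule hmul_ccomp[where k'="tid X E"]) simp_all
    also have "\<dots> = hmul E (hunit r) \<psi>"
      using fv e by (simp add: flat_def)
    also have "\<dots> = \<psi>"
      by (rule hmul_hunit_left) simp_all
    finally show "\<psi> = \<psi>1" by simp
  qed
qed

text \<open>\<open>flat j r \<alpha>\<close> is the cartesian cell of \<open>E(j,r)\<close> after
  \<open>\<alpha>\<close>. Inserting \<open>\<beta>\<close> in the first slot therefore turns the
  equation into the one solved for \<open>E(j,r)\<close>, reversibly.\<close>

lemma density_transport: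
  assumes T: "j \<in> Tight X" "r \<in> Tight X" and dc: "tdom X j = A" "tcod X j = E" "tdom X r = C" "tcod X r = E"
    and dense: "\<And>rs \<theta>. lcell E j (hom X j (tid X E) # rs) (tid X E) \<theta> \<Longrightarrow>
      \<exists>!\<psi>. lcell E (tid X E) rs (tid X E) \<psi> \<and> hmul E (hom_cell X j (tid X E)) \<psi> = \<theta>"
    and iso: "iso_gcell X \<alpha> p (hom X j r)"
    and \<theta>: "lcell E j (p # rs) (tid X E) \<theta>"
  shows "\<exists>!\<psi>. lcell E r rs (tid X E) \<psi> \<and> hmul E (flat j r \<alpha>) \<psi> = \<theta>"
proof -
  let ?\<kappa> = "hom_cell X j r" and ?rs = "map (cid X) rs"
  have O [simp]: "A \<in> Obj X" "C \<in> Obj X" "E \<in> Obj X"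
    using T dc by auto
  note [simp] = T dc
  have t [simp]: "\<theta> \<in> Cell X" "cdom X \<theta> = p # rs" "ccod X \<theta> = lid X E" "cleft X \<theta> = j"
      "cright X \<theta> = tid X E"
    using \<theta> by (auto simp: lcell_def)
  obtain \<beta> where \<alpha>: "gcell X \<alpha> [p] (hom X j r)" and \<beta>: "gcell X \<beta> [hom X j r] p"
    and inv: "gcomp X \<beta> [\<alpha>] = cid X p" "gcomp X \<alpha> [\<beta>] = cid X (hom X j r)"
    using iso by (auto simp: iso_gcell_def)
  have a [simp]: "\<alpha> \<in> Cell X" "cdom X \<alpha> = [p]" "ccod X \<alpha> = hom X j r" "cleft X \<alpha> = tid X A" "cright X \<alpha> = tid X C"
    using \<alpha> by (auto simp: gcell_def)
  have pl [simp]: "p \<in> Loose X" "ltgt X p = A" "lsrc X p = C"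
    using cell_dom[of \<alpha>] by auto
  have b [simp]: "\<beta> \<in> Cell X" "cdom X \<beta> = [hom X j r]" "ccod X \<beta> = p" "cleft X \<beta> = tid X A" "cright X \<beta> = tid X C"
    using \<beta> by (auto simp: gcell_def)
  have ch: "chain X C rs E"
    using cell_dom[of \<theta>] by simp
  have rs [simp]: "juxt X (tid X C) ?rs (tid X E)" "set rs \<subseteq> Loose X"
    using juxt_cids[OF ch] chain_Loose[OF ch] by auto
  let ?\<theta>' = "ccomp X \<theta> (tid X A) (\<beta> # ?rs)"
  have "lcell E j (hom X j r # rs) (tid X E) ?\<theta>'"
    using ccomp_simps[of \<theta> "tid X A" "\<beta> # ?rs" "tid X E"] by (simp add: lcell_def)
  note ex = density_restrict[OF T dc dense this]
  have "hmul E (flat j r \<alpha>) \<psi> = \<theta> \<longleftrightarrow> hmul E ?\<kappa> \<psi> = ?\<theta>'" if "lcell E r rs (tid X E) \<psi>" for \<psi>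
  proof -
    have p [simp]: "\<psi> \<in> Cell X" "cdom X \<psi> = rs" "ccod X \<psi> = lid X E" "cleft X \<psi> = r"
        "cright X \<psi> = tid X E"
      using that by (auto simp: lcell_def)
    have "hmul E (ccomp X ?\<kappa> (tid X A) [\<alpha>]) (ccomp X \<psi> (tid X C) ?rs) =
        ccomp X (hmul E ?\<kappa> \<psi>) (tid X A) ([\<alpha>] @ ?rs)"
      by (rule hmul_ccomp[where k'="tid X E", symmetric]) simp_all
    moreover have "ccomp X \<psi> (tid X C) ?rs = \<psi>"
      by (rule ccomp_cids_right) simp_all
    ultimately have eq: "hmul E (flat j r \<alpha>) \<psi> = ccomp X (hmul E ?\<kappa> \<psi>) (tid X A) (\<alpha> # ?rs)"
      by (simp add: flat_def)
    have "ccomp X ?\<theta>' (tid X A) (\<alpha> # ?rs) = \<theta>"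
      by (rule whisker_inverse[OF _ _ _ \<beta> \<alpha> inv(1)]) simp_all
    moreover have "ccomp X (ccomp X (hmul E ?\<kappa> \<psi>) (tid X A) (\<alpha> # ?rs)) (tid X A) (\<beta> # ?rs) = hmul E ?\<kappa> \<psi>"
      by (rule whisker_inverse[OF _ _ _ \<alpha> \<beta> inv(2)]) simp_all
    ultimately show ?thesis
      using eq by auto
  qed
  then have "(\<lambda>\<psi>. lcell E r rs (tid X E) \<psi> \<and> hmul E (flat j r \<alpha>) \<psi> = \<theta>) =
      (\<lambda>\<psi>. lcell E r rs (tid X E) \<psi> \<and> hmul E ?\<kappa> \<psi> = ?\<theta>')"
    by blast
  with ex show ?thesis by simp
qed

text \<open>The extension cell that density attaches to \<open>frown X j\<close> is the identity of
  \<open>E(j,1)\<close>: by Yoneda this holds because the identity, evaluated at the universal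
  element, gives the unit of \<open>j\<close>. Its flat form is the cartesian cell.\<close>

lemma dense_tight_flat:
  assumes "dense_tight X j" and "j \<in> Tight X" and "tcod X j = E"
    and "lcell E j (hom X j (tid X E) # rs) (tid X E) \<theta>"
  shows "\<exists>!\<psi>. lcell E (tid X E) rs (tid X E) \<psi> \<and> hmul E (hom_cell X j (tid X E)) \<psi> = \<theta>"
proof -
  define A where "A = tdom X j"
  let ?H = "hom X j (tid X E)"
  have O [simp]: "A \<in> Obj X" "E \<in> Obj X"
    using assms(2,3) by (auto simp: A_def)
  have j [simp]: "j \<in> Tight X" "tcod X j = E" "tdom X j = A"
    using assms by (auto simp: A_def)
  obtain u where u: "u \<in> Cell X" "cdom X u = []" "ccod X u = ?H" "cleft X u = tid X A"
    "cright X u = j" "flat j (tid X E) u = hunit j"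
    using universal_element[of j A E] j by blast
  have g: "gcell X (cid X ?H) [?H] ?H"
    by (simp add: gcell_def)
  have "ccomp X (flat j (tid X E) (cid X ?H)) (tid X A) [u] = flat j (tid X E) u"
    using u by (simp add: flat_cid) (simp add: flat_def)
  then have "ext_cell X j j (tid X E) (frown X j) = cid X ?H"
    using u by (intro ext_cell_eq[where A=A and C=E and E=E and u=u]) (simp_all add: g gcell_def)
  then have "is_colimit X ?H j (tid X E) (cid X ?H)"
    using assms(1) by (auto simp: dense_tight_def is_left_extension_def tight_cell_def)
  then show ?thesis
    using is_colimit_iff[of j "tid X E" E ?H "cid X ?H"] assms(4) g by (simp add: flat_cid)
qed

section \<open>The two implications\<close>

theorem absolute_left_extension_imp_adjunction:
  assumes "tight_cell X j A E" and "tight_cell X l A C" and "fully_faithful X j"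
    and ext: "absolute_left_extension X j l j e \<pi>"
  shows "\<exists>\<alpha>. relative_adjunction X j l e \<alpha>"
proof -
  have jl: "j \<in> Tight X" "tdom X j = A" "tcod X j = E" "l \<in> Tight X" "tdom X l = A" "tcod X l = C"
    using assms(1,2) by (auto simp: tight_cell_def)
  define p where "p = hom X l (tid X C)"
  define lam where "lam = ext_cell X l j e \<pi>"
  have e: "e \<in> Tight X" "tdom X e = C" "tcod X e = E"
    using ext jl by (auto simp: absolute_left_extension_def is_left_extension_def tight_cell_def)
  have O: "A \<in> Obj X" "C \<in> Obj X" "E \<in> Obj X"
    using jl by auto
  have lam: "gcell X lam [p] (hom X j e)"
    and op: "left_opcartesian X (gcomp X (smile_at X j j e) [cid X (hom X j j), lam])"
    using ext jl
    by (auto simp: absolute_left_extension_def absolute_colimit_def is_colimit_def p_def lam_def)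
  have s: "smile_at X j j e \<in> Cell X" "cdom X (smile_at X j j e) = [hom X j j, hom X j e]"
      "ccod X (smile_at X j j e) = hom X j e" "cleft X (smile_at X j j e) = tid X A"
      "cright X (smile_at X j j e) = tid X C"
    using smile_at_simps(1)[of j j e E] jl e by (auto simp: gcell_def)
  have la: "lam \<in> Cell X" "cdom X lam = [p]" "ccod X lam = hom X j e" "cleft X lam = tid X A"
      "cright X lam = tid X C"
    using lam jl e by (auto simp: gcell_def)
  have "gcell X (gcomp X (smile_at X j j e) [cid X (hom X j j), lam]) [hom X j j, p] (hom X j e)"
    using s la jl e O by (simp add: gcell_def gcomp_def)
  moreover have "opcartesian X (frown X j)" "gcell X (frown X j) [] (hom X j j)"
    using assms(3) jl by (auto simp: fully_faithful_def gcell_def)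
  ultimately have "\<exists>\<alpha>. iso_gcell X \<alpha> p (hom X j e)"
    using left_opcartesian_imp_iso op by blast
  then show ?thesis
    using assms(1,2) e by (auto simp: relative_adjunction_def tight_cell_def p_def)
qed

text \<open>The given \<open>\<alpha>\<close> is itself made the colimit cell, by choosing
  \<open>\<pi>\<close> with extension cell \<open>\<alpha>\<close>. Universality and absoluteness
  are then both statements about one isomorphism.\<close>

theorem adjunction_imp_absolute_left_extension:
  assumes "tight_cell X j A E" and "tight_cell X l A C" and "fully_faithful X j"
    and "dense_tight X j" and adj: "relative_adjunction X j l r \<alpha>"
  shows "\<exists>\<pi>. is_left_extension X l j r \<pi> \<and> absolute_left_extension X j l j r \<pi>"
proof -
  have jl: "j \<in> Tight X" "tdom X j = A" "tcod X j = E" "l \<in> Tight X" "tdom X l = A" "tcod X l = C"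
    using assms(1,2) by (auto simp: tight_cell_def)
  define p where "p = hom X l (tid X C)"
  have r: "r \<in> Tight X" "tdom X r = C" "tcod X r = E" and iso: "iso_gcell X \<alpha> p (hom X j r)"
    using adj jl by (auto simp: relative_adjunction_def tight_cell_def p_def)
  have O: "A \<in> Obj X" "C \<in> Obj X" "E \<in> Obj X"
    using jl by auto
  have p: "p \<in> Loose X" "ltgt X p = A" "lsrc X p = C"
    using jl O by (auto simp: p_def)
  have \<alpha>: "gcell X \<alpha> [p] (hom X j r)"
    using iso by (simp add: iso_gcell_def)
  obtain \<pi> where \<pi>: "tight_2cell X \<pi> j (tcomp X r l)" "ext_cell X l j r \<pi> = \<alpha>"
    using ext_cell_surj[of j l r A E C \<alpha>] jl r \<alpha> by (auto simp: p_def)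
  have "is_colimit X p j r \<alpha>"
    using is_colimit_iff[of j r E p \<alpha>] jl r p \<alpha> iso
      density_transport[OF jl(1) r(1) jl(2,3) r(2,3) dense_tight_flat[OF assms(4) jl(1,3)]] by simp
  then have ext: "is_left_extension X l j r \<pi>"
    using \<pi> jl r by (auto simp: is_left_extension_def tight_cell_def p_def)
  let ?\<sigma> = "gcomp X (smile_at X j j r) [cid X (hom X j j), \<alpha>]"
  have s: "smile_at X j j r \<in> Cell X" "cdom X (smile_at X j j r) = [hom X j j, hom X j r]"
      "ccod X (smile_at X j j r) = hom X j r" "cleft X (smile_at X j j r) = tid X A"
      "cright X (smile_at X j j r) = tid X C"
    using smile_at_simps(1)[of j j r E] jl r by (auto simp: gcell_def)
  have a: "\<alpha> \<in> Cell X" "cdom X \<alpha> = [p]" "ccod X \<alpha> = hom X j r" "cleft X \<alpha> = tid X A"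
      "cright X \<alpha> = tid X C"
    using \<alpha> jl r by (auto simp: gcell_def)
  have \<sigma>: "gcell X ?\<sigma> [hom X j j, p] (hom X j r)"
    using s a jl r O by (simp add: gcell_def gcomp_def)
  have c1: "ccomp X (cid X (hom X j j)) (tid X A) [frown X j] = frown X j"
    by (rule ccomp_cid_left) (use jl in simp_all)
  have c2: "ccomp X \<alpha> (tid X A) [cid X p] = \<alpha>"
    by (rule ccomp_cid_right) (use a O in simp_all)
  have "composable X (smile_at X j j r) (tid X A) [cid X (hom X j j), \<alpha>] (tid X C)"
    using s a jl r O by (simp add: composable_def)
  \<comment> \<open>Inserting the unit of \<open>j\<close> leaves the counit applied to
    \<open>frown X j\<close> and \<open>\<alpha>\<close>, which the triangle identity collapses to
    \<open>\<alpha>\<close>.\<close>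
  from ccomp_assoc[OF this, of "tid X A" "[[frown X j], [cid X p]]" "tid X C"]
  have "gcomp X ?\<sigma> [frown X j, cid X p] = ccomp X (smile_at X j j r) (tid X A) [frown X j, \<alpha>]"
    using s a jl r O p c1 c2 by (simp add: gcomp_def)
  also have "\<dots> = \<alpha>"
    by (rule smile_at_frown) (use a jl r in simp_all)
  finally have "iso_gcell X (gcomp X ?\<sigma> [frown X j, cid X p]) p (hom X j r)"
    using iso by simp
  moreover have "opcartesian X (frown X j)" "gcell X (frown X j) [] (hom X j j)"
    using assms(3) jl by (auto simp: fully_faithful_def gcell_def)
  ultimately have "left_opcartesian X ?\<sigma>"
    using iso_imp_left_opcartesian[OF _ _ \<sigma>] by blast
  with ext \<open>is_colimit X p j r \<alpha>\<close> \<pi>(2) jl show ?thesis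
    by (auto simp: absolute_left_extension_def absolute_colimit_def p_def)
qed

end

theorem proposition5p10:
  fixes X :: "('o, 't, 'l, 'c) vdc" and A C E :: 'o and j l :: 't
  assumes "virtual_equipment X"
    and "tight_cell X j A E" and "tight_cell X l A C"
    and "fully_faithful X j"
  shows "(\<forall>e \<pi>. is_left_extension X l j e \<pi> \<and> absolute_left_extension X j l j e \<pi> \<longrightarrow>
            (\<exists>\<alpha>. relative_adjunction X j l e \<alpha>)) \<and>
         (dense_tight X j \<longrightarrow>
            (\<forall>r \<alpha>. relative_adjunction X j l r \<alpha> \<longrightarrow>
              (\<exists>\<pi>. is_left_extension X l j r \<pi> \<and> absolute_left_extension X j l j r \<pi>)))"
  using virtual_equipment.absolute_left_extension_imp_adjunction[OF assms]
    virtual_equipment.adjunction_imp_absolute_left_extension[OF assms]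
  by blast

end
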